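(* Let $S$ be a semitopological semigroup with a bi-invariant mean $m$ on $W(S)$, let $E$ be a Banach space, and let $\pi$ be a relatively weakly compact representation of $S$ on $E$. For $\xi\in E$, the following are equivalent: (i) $\xi\in E_{\mathrm{aws}}$. (ii) For all $p>0$ and all $f'\in E'$, $m\left(s\mapsto|f'(\pi_s\xi)|^p\right)=0$. (iii) There exists $p>0$ such that for all $f'\in E'$, $m\left(s\mapsto|f'(\pi_s\xi)|^p\right)=0$.
   Context: Banach spaces are complex; $E'$ is the dual of $E$. $\mathcal{L}(E)$ is the space of bounded linear operators on $E$; for sets of operators, "weakly" and the closure $\operatorname{cl}_\sigma$ refer to the weak operator topology. A semitopological semigroup is a semigroup with a Hausdorff topology for which multiplication is separately continuous. For $f\in C_b(S)$ (bounded continuous complex functions) put $(R_sf)(t)=f(ts)$ and $(L_sf)(t)=f(st)$. $W(S)$, the space of weakly almost periodic functions, is the set of $f\in C_b(S)$ such that $\{R_sf:s\in S\}$ is relatively weakly compact in $C_b(S)$. A bi-invariant mean on $W(S)$ is a positive linear functional $m:W(S)\to\mathbb{C}$ of norm $1$ with $m(L_sf)=m(f)=m(R_sf)$ for all $s\in S$, $f\in W(S)$. A representation $\pi$ of $S$ on $E$ is a semigroup homomorphism $\pi:S\to\mathcal{L}(E)$, $s\mapsto\pi_s$, continuous for the weak operator topology (with $\pi_e=\mathrm{Id}$ if $S$ has an identity $e$). It is relatively weakly compact if $\pi(S)$ is relatively compact in the weak operator topology; in this case the functions $s\mapsto|f'(\pi_s\xi)|^p$ ($\xi\in E$, $f'\in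 E'$, $p>0$) belong to $W(S)$. With $\mathscr{S}:=\operatorname{cl}_\sigma(\pi(S))$, $E_{\mathrm{aws}}=\{\xi\in E:u\xi=0\text{ for some }u\in\mathscr{S}\}$. *)

theory Defs
  imports "HOL-Analysis.Analysis"
begin

section \<open>Complex normed spaces\<close>

text \<open>The distribution only has real normed spaces; a complex one is a real one with a
  compatible complex scalar multiplication.\<close>

class complex_normed_vector = real_normed_vector +
  fixes scaleC :: "complex \<Rightarrow> 'a \<Rightarrow> 'a" (infixr "*\<^sub>C" 75)
  assumes scaleC_add_right: "c *\<^sub>C (x + y) = c *\<^sub>C x + c *\<^sub>C y"
    and scaleC_add_left: "(c + d) *\<^sub>C x = c *\<^sub>C x + d *\<^sub>C x"
    and scaleC_scaleC: "c *\<^sub>C d *\<^sub>C x = (c * d) *\<^sub>C x"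
    and scaleC_of_real: "complex_of_real r *\<^sub>C x = r *\<^sub>R x"
    and norm_scaleC: "norm (c *\<^sub>C x) = cmod c * norm x"

class complex_banach = complex_normed_vector + banach

instantiation complex :: complex_banach
begin

definition scaleC_complex :: "complex \<Rightarrow> complex \<Rightarrow> complex"
  where "scaleC_complex c z = c * z"

instance
  by standard (simp_all add: scaleC_complex_def distrib_left distrib_right norm_mult scaleR_conv_of_real)

end

unbundle bcontfun.lifting

text \<open>The domain is merely a topological space, so \<open>C\<^sub>b(S)\<close> is only made an instance of the
  normed class here: the library proves completeness only for metric domains.\<close>

instantiation bcontfun :: (topological_space, complex_normed_vector) complex_normed_vector
begin

lemma continuous_on_scaleC:
  fixes f :: "'c::topological_space \<Rightarrow> 'd::complex_normed_vector"
  assumes "continuous_on A f"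
  shows "continuous_on A (\<lambda>x. c *\<^sub>C f x)"
proof -
  have "bounded_linear (\<lambda>x::'d. c *\<^sub>C x)"
  proof (rule bounded_linear_intro)
    fix r :: real and x :: 'd
    have "c *\<^sub>C complex_of_real r *\<^sub>C x = complex_of_real r *\<^sub>C c *\<^sub>C x"
      by (simp add: scaleC_scaleC mult.commute)
    then show "c *\<^sub>C r *\<^sub>R x = r *\<^sub>R c *\<^sub>C x"
      by (simp add: scaleC_of_real)
  next
    show "norm (c *\<^sub>C x) \<le> norm x * cmod c" for x :: 'd
      by (simp add: norm_scaleC mult.commute)
  qed (rule scaleC_add_right)
  then show ?thesis
    using assms by (rule bounded_linear.continuous_on)
qed

lemma scaleC_cont:
  fixes f :: "'a \<Rightarrow> 'b"
  assumes "f \<in> bcontfun"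
  shows "(\<lambda>x. c *\<^sub>C f x) \<in> bcontfun"
proof -
  obtain b where b: "norm (f x) \<le> b" for x
    using assms by (auto simp: bcontfun_def bounded_iff)
  show ?thesis
  proof (rule bcontfun_normI)
    show "continuous_on UNIV (\<lambda>x. c *\<^sub>C f x)"
      using assms by (intro continuous_on_scaleC) (simp add: bcontfun_def)
    show "norm (c *\<^sub>C f x) \<le> cmod c * b" for x
      unfolding norm_scaleC by (intro mult_left_mono b) simp
  qed
qed

lift_definition scaleC_bcontfun :: "complex \<Rightarrow> ('a \<Rightarrow>\<^sub>C 'b) \<Rightarrow> 'a \<Rightarrow>\<^sub>C 'b"
  is "\<lambda>c f x. c *\<^sub>C f x"
  by (rule scaleC_cont)

instance
proof
  fix c d :: complex and r :: real and f g :: "'a \<Rightarrow>\<^sub>C 'b"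
  show "c *\<^sub>C (f + g) = c *\<^sub>C f + c *\<^sub>C g"
    by transfer (simp add: scaleC_add_right)
  show "(c + d) *\<^sub>C f = c *\<^sub>C f + d *\<^sub>C f"
    by transfer (simp add: scaleC_add_left)
  show cd: "c *\<^sub>C d *\<^sub>C f = (c * d) *\<^sub>C f" for c d and f :: "'a \<Rightarrow>\<^sub>C 'b"
    by transfer (simp add: scaleC_scaleC)
  show re: "complex_of_real r *\<^sub>C f = r *\<^sub>R f" for r and f :: "'a \<Rightarrow>\<^sub>C 'b"
    by transfer (simp add: scaleC_of_real)
  have le: "norm (c *\<^sub>C f) \<le> cmod c * norm f" for c and f :: "'a \<Rightarrow>\<^sub>C 'b"
  proof (rule norm_bound)
    show "norm (apply_bcontfun (c *\<^sub>C f) x) \<le> cmod c * norm f" for x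
      by (simp add: scaleC_bcontfun.rep_eq norm_scaleC mult_left_mono norm_bounded)
  qed
  show "norm (c *\<^sub>C f) = cmod c * norm f"
  proof (cases "c = 0")
    case True
    then show ?thesis using re[of 0 f] by simp
  next
    case False
    have "f = inverse c *\<^sub>C c *\<^sub>C f"
      using False re[of 1 f] by (simp add: cd)
    then have "norm f \<le> cmod (inverse c) * norm (c *\<^sub>C f)"
      using le[of "inverse c" "c *\<^sub>C f"] by simp
    then have "cmod c * norm f \<le> norm (c *\<^sub>C f)"
      using False by (simp add: norm_inverse norm_divide field_simps)
    with le[of c f] show ?thesis by simp
  qed
qed

end

definition bounded_clinear :: "('a::complex_normed_vector \<Rightarrow> 'b::complex_normed_vector) \<Rightarrow> bool"
  where "bounded_clinear u \<longleftrightarrow> bounded_linear u \<and> (\<forall>c x. u (c *\<^sub>C x) = c *\<^sub>C u x)"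

definition dual_space :: "('a::complex_normed_vector \<Rightarrow> complex) set"
  where "dual_space = {f. bounded_clinear f}"


section \<open>Weak topologies\<close>

definition weak_topology :: "'a::complex_normed_vector topology"
  where "weak_topology = topology_generated_by {{x. f x \<in> U} |f U. f \<in> dual_space \<and> open U}"

text \<open>The underlying set of the weak operator topology is \<open>\<L>(E)\<close>, not all functions.\<close>

definition weak_operator_topology :: "('a::complex_banach \<Rightarrow> 'a) topology"
  where "weak_operator_topology = topology_generated_by
    {{u. bounded_clinear u \<and> f (u x) \<in> U} |x f U. f \<in> dual_space \<and> open U}"

lemma topspace_weak_topology [simp]: "topspace weak_topology = UNIV"
proof -
  have "(\<lambda>_. 0) \<in> dual_space"
    by (simp add: dual_space_def bounded_clinear_def scaleC_complex_def)
  then show ?thesis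
    unfolding weak_topology_def topology_generated_by_topspace by blast
qed

lemma topspace_weak_operator_topology [simp]:
  "topspace weak_operator_topology = {u. bounded_clinear u}"
proof -
  have "(\<lambda>_. 0) \<in> dual_space"
    by (simp add: dual_space_def bounded_clinear_def scaleC_complex_def)
  then show ?thesis
    unfolding weak_operator_topology_def topology_generated_by_topspace by blast
qed

definition relatively_compact_in :: "'a topology \<Rightarrow> 'a set \<Rightarrow> bool"
  where "relatively_compact_in T A \<longleftrightarrow> A \<subseteq> topspace T \<and> compactin T (T closure_of A)"


section \<open>Semitopological semigroups and weakly almost periodic functions\<close>

class semitopological_semigroup = semigroup_mult + t2_space +
  assumes open_vimage_mult_left: "open U \<Longrightarrow> open ((\<lambda>t. s * t) -` U)"
    and open_vimage_mult_right: "open U \<Longrightarrow> open ((\<lambda>t. t * s) -` U)"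

lemma continuous_mult_left: "continuous_on UNIV (\<lambda>t::'s::semitopological_semigroup. s * t)"
  by (simp add: continuous_on_open_vimage open_vimage_mult_left)

lemma continuous_mult_right: "continuous_on UNIV (\<lambda>t::'s::semitopological_semigroup. t * s)"
  by (simp add: continuous_on_open_vimage open_vimage_mult_right)

lift_definition right_translate ::
    "'s::semitopological_semigroup \<Rightarrow> ('s \<Rightarrow>\<^sub>C complex) \<Rightarrow> ('s \<Rightarrow>\<^sub>C complex)"
  is "\<lambda>s f t. f (t * s)"
  by (auto simp: bcontfun_def intro: bounded_subset
      intro!: continuous_on_compose2[OF _ continuous_mult_right])

lift_definition left_translate ::
    "'s::semitopological_semigroup \<Rightarrow> ('s \<Rightarrow>\<^sub>C complex) \<Rightarrow> ('s \<Rightarrow>\<^sub>C complex)"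
  is "\<lambda>s f t. f (s * t)"
  by (auto simp: bcontfun_def intro: bounded_subset
      intro!: continuous_on_compose2[OF _ continuous_mult_left])

definition wap :: "('s::semitopological_semigroup \<Rightarrow>\<^sub>C complex) set"
  where "wap = {f. relatively_compact_in weak_topology (range (\<lambda>s. right_translate s f))}"

text \<open>A functional on \<^term>\<open>wap\<close> is represented by a function on all of \<open>C\<^sub>b(S)\<close> whose values
  outside \<^term>\<open>wap\<close> are irrelevant; the last two conditions say that its operator norm on
  \<^term>\<open>wap\<close> is 1.\<close>

definition bi_invariant_mean ::
    "(('s::semitopological_semigroup \<Rightarrow>\<^sub>C complex) \<Rightarrow> complex) \<Rightarrow> bool"
  where "bi_invariant_mean m \<longleftrightarrow>
    (\<forall>f\<in>wap. \<forall>g\<in>wap. m (f + g) = m f + m g) \<and>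
    (\<forall>c. \<forall>f\<in>wap. m (c *\<^sub>C f) = c * m f) \<and>
    (\<forall>f\<in>wap. (\<forall>t. apply_bcontfun f t \<in> \<real>\<^sub>\<ge>\<^sub>0) \<longrightarrow> m f \<in> \<real>\<^sub>\<ge>\<^sub>0) \<and>
    (\<forall>s. \<forall>f\<in>wap. m (left_translate s f) = m f \<and> m (right_translate s f) = m f) \<and>
    bdd_above ((\<lambda>f. cmod (m f)) ` {f\<in>wap. norm f \<le> 1}) \<and>
    (SUP f\<in>{f\<in>wap. norm f \<le> 1}. cmod (m f)) = 1"


section \<open>Representations\<close>

definition representation :: "('s::semitopological_semigroup \<Rightarrow> 'e::complex_banach \<Rightarrow> 'e) \<Rightarrow> bool"
  where "representation \<pi> \<longleftrightarrow>
    (\<forall>s. bounded_clinear (\<pi> s)) \<and>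
    (\<forall>s t. \<pi> (s * t) = \<pi> s \<circ> \<pi> t) \<and>
    (\<forall>e. (\<forall>s. e * s = s \<and> s * e = s) \<longrightarrow> \<pi> e = id) \<and>
    continuous_map euclidean weak_operator_topology \<pi>"

definition relatively_weakly_compact_rep ::
    "('s::semitopological_semigroup \<Rightarrow> 'e::complex_banach \<Rightarrow> 'e) \<Rightarrow> bool"
  where "relatively_weakly_compact_rep \<pi> \<longleftrightarrow>
    representation \<pi> \<and> relatively_compact_in weak_operator_topology (range \<pi>)"

definition E_aws :: "('s::semitopological_semigroup \<Rightarrow> 'e::complex_banach \<Rightarrow> 'e) \<Rightarrow> 'e set"
  where "E_aws \<pi> = {\<xi>. \<exists>u \<in> weak_operator_topology closure_of (range \<pi>). u \<xi> = 0}"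

text \<open>The element \<open>s \<mapsto> |f'(\<pi>\<^sub>s \<xi>)|\<^sup>p\<close> of \<open>C\<^sub>b(S)\<close>. As \<^const>\<open>Bcontfun\<close> is only meaningful on
  bounded continuous functions, the lemma \<open>apply_coefficient_power\<close> below is what makes
  this definition usable.\<close>

definition coefficient_power ::
    "('s::semitopological_semigroup \<Rightarrow> 'e::complex_banach \<Rightarrow> 'e) \<Rightarrow> 'e \<Rightarrow> ('e \<Rightarrow> complex) \<Rightarrow> real
      \<Rightarrow> ('s \<Rightarrow>\<^sub>C complex)"
  where "coefficient_power \<pi> \<xi> f' p =
    Bcontfun (\<lambda>s. complex_of_real (cmod (f' (\<pi> s \<xi>)) powr p))"

lemma continuous_map_coefficient:
  assumes "f' \<in> dual_space"
  shows "continuous_map weak_operator_topology euclidean (\<lambda>u. f' (u \<xi>))"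
  unfolding continuous_map
proof (intro conjI allI impI)
  fix U :: "complex set"
  assume "openin euclidean U"
  then have "openin weak_operator_topology {u. bounded_clinear u \<and> f' (u \<xi>) \<in> U}"
    unfolding weak_operator_topology_def
    by (intro topology_generated_by_Basis) (use assms in auto)
  then show "openin weak_operator_topology
      {u \<in> topspace weak_operator_topology. f' (u \<xi>) \<in> U}"
    by simp
qed simp

lemma coefficient_power_in_bcontfun:
  assumes "relatively_weakly_compact_rep \<pi>" "f' \<in> dual_space" "p > 0"
  shows "(\<lambda>s. complex_of_real (cmod (f' (\<pi> s \<xi>)) powr p)) \<in> bcontfun"
proof -
  let ?K = "weak_operator_topology closure_of (range \<pi>)"
  have rep: "continuous_map euclidean weak_operator_topology \<pi>"
    and sub: "range \<pi> \<subseteq> topspace weak_operator_topology"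
    and K: "compactin weak_operator_topology ?K"
    using assms(1)
    by (auto simp: relatively_weakly_compact_rep_def representation_def relatively_compact_in_def)
  have "continuous_map euclidean euclidean ((\<lambda>u. f' (u \<xi>)) \<circ> \<pi>)"
    using rep continuous_map_coefficient[OF assms(2)] by (rule continuous_map_compose)
  then have cont: "continuous_on UNIV (\<lambda>s. f' (\<pi> s \<xi>))"
    by (simp add: o_def)
  have "compactin euclidean ((\<lambda>u. f' (u \<xi>)) ` ?K)"
    using K continuous_map_coefficient[OF assms(2)] by (rule image_compactin)
  then have "bounded ((\<lambda>u. f' (u \<xi>)) ` ?K)"
    by (simp add: compact_imp_bounded)
  then obtain b where b: "cmod (f' (u \<xi>)) \<le> b" if "u \<in> ?K" for u
    by (auto simp: bounded_iff)
  have "\<pi> s \<in> ?K" for s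
    using closure_of_subset[OF sub] by auto
  then have b': "cmod (f' (\<pi> s \<xi>)) \<le> b" for s
    by (rule b)
  show ?thesis
  proof (rule bcontfun_normI)
    show "continuous_on UNIV (\<lambda>s. complex_of_real (cmod (f' (\<pi> s \<xi>)) powr p))"
      by (intro continuous_intros continuous_on_powr' cont) (use assms(3) in auto)
    show "cmod (complex_of_real (cmod (f' (\<pi> s \<xi>)) powr p)) \<le> b powr p" for s
      using b'[of s] assms(3) by (simp add: powr_mono2)
  qed
qed

lemma apply_coefficient_power:
  assumes "relatively_weakly_compact_rep \<pi>" "f' \<in> dual_space" "p > 0"
  shows "apply_bcontfun (coefficient_power \<pi> \<xi> f' p) s
    = complex_of_real (cmod (f' (\<pi> s \<xi>)) powr p)"
  unfolding coefficient_power_def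
  by (simp add: Bcontfun_inverse coefficient_power_in_bcontfun[OF assms])

end

(*
  Write K for the weak operator closure of pi(S), a compact semigroup. The functions
  |f'(v u xi)|^p are bounded and separately continuous in (v, u) : K x K. If u0 lies in the closure
  of a set A, then Eberlein's argument gives a sequence u_n in A with
  |f'(v u_n xi)|^p --> |f'(v u0 xi)|^p for every v in K, and Simons' inequality turns this pointwise
  convergence into uniformly small convex combinations of the absolute differences, without any
  representing measures.

  On the one hand, u |-> |f'(pi(.) u xi)|^p is then continuous from K into the weak topology of
  C_b(S), since no bounded functional can separate u0 from A; so these functions belong to W(S). On
  the other hand, if u0 xi = 0, the convex combinations with A = pi(S) dominate convex combinations
  of right translates of |f'(pi(.) xi)|^p, all of which have the same mean; this gives (ii).

  Conversely, if the means for one p vanish, so does the mean of any finite positive combination of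
  the functions |f'(pi(.) xi)|^p, which is therefore not bounded below by 1. Hence finitely many
  conditions |f'(u xi)| <= e can be satisfied within pi(S), and compactness of K yields u in K with
  f'(u xi) = 0 for all f', whence u xi = 0 by the Hahn-Banach theorem.
*)
theory Submission
  imports Defs
begin

section \<open>Sublinear functionals and the Hahn-Banach theorem\<close>

section \<open>Linear functionals\<close>


definition sublinear :: "('a::real_vector \<Rightarrow> real) \<Rightarrow> bool"
  where "sublinear p \<longleftrightarrow> (\<forall>x y. p (x + y) \<le> p x + p y) \<and> (\<forall>r\<ge>0. \<forall>x. p (r *\<^sub>R x) = r * p x)"

lemma sublinear_add: "sublinear p \<Longrightarrow> p (x + y) \<le> p x + p y"
  and sublinear_scaleR: "sublinear p \<Longrightarrow> r \<ge> 0 \<Longrightarrow> p (r *\<^sub>R x) = r * p x"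
  by (auto simp: sublinear_def)

lemma sublinear_zero: "sublinear p \<Longrightarrow> p 0 = 0"
  using sublinear_scaleR[of p 0 0] by simp

lemma sublinear_neg: "sublinear p \<Longrightarrow> - p (- x) \<le> p x"
  using sublinear_add[of p x "- x"] sublinear_zero[of p] by simp

lemma sublinearI:
  assumes "\<And>x y. p (x + y) \<le> p x + p y" "\<And>r x. r > 0 \<Longrightarrow> p (r *\<^sub>R x) \<le> r * p x" "p 0 = 0"
  shows "sublinear p"
  unfolding sublinear_def
proof (intro conjI allI impI)
  fix r :: real and x assume r: "r \<ge> 0"
  show "p (r *\<^sub>R x) = r * p x"
  proof (cases "r = 0")
    case False
    then have "p x \<le> inverse r * p (r *\<^sub>R x)"
      using assms(2)[of "inverse r" "r *\<^sub>R x"] r by simp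
    then have "r * p x \<le> p (r *\<^sub>R x)"
      using False r by (simp add: field_simps)
    then show ?thesis using assms(2)[of r x] False r by simp
  qed (use assms(3) in simp)
qed (rule assms(1))

text \<open>The new functional minimises p along the ray from x in direction a, with the growth
  \<open>t * p a\<close> subtracted. Subadditivity bounds the candidates below by
  \<open>- p (- x)\<close>; t = 0 gives q \<le> p, and t = 1 at the point \<open>- a\<close> gives
  the last inequality.\<close>

lemma sublinear_shift:
  assumes p: "sublinear p"
  obtains q where "sublinear q" "\<And>x. q x \<le> p x" "q (- a) \<le> - p a"
proof
  define B where "B x = (\<lambda>t. p (x + t *\<^sub>R a) - t * p a) ` {0..}" for x
  define q where "q x = Inf (B x)" for x
  have low: "- p (- x) \<le> p (x + t *\<^sub>R a) - t * p a" if "t \<ge> 0" for x t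
    using sublinear_add[OF p, of "x + t *\<^sub>R a" "- x"] sublinear_scaleR[OF p that, of a] by simp
  then have bdd: "bdd_below (B x)" for x
    by (auto simp: B_def intro!: bdd_belowI)
  have le: "q x \<le> p (x + t *\<^sub>R a) - t * p a" if "t \<ge> 0" for x t
    unfolding q_def using that by (intro cInf_lower bdd) (auto simp: B_def)
  have ge: "c \<le> q x" if "\<And>t. t \<ge> 0 \<Longrightarrow> c \<le> p (x + t *\<^sub>R a) - t * p a" for c x
    unfolding q_def using that by (intro cInf_greatest) (auto simp: B_def)
  show qp: "q x \<le> p x" for x
    using le[of 0 x] by simp
  show "q (- a) \<le> - p a"
    using le[of 1 "- a"] sublinear_zero[OF p] by simp
  show "sublinear q"
  proof (rule sublinearI)
    fix x y
    have "q (x + y) - (p (y + t *\<^sub>R a) - t * p a) \<le> q x" if t: "t \<ge> 0" for t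
    proof (rule ge)
      fix s :: real assume s: "s \<ge> 0"
      have "p (x + y + (s + t) *\<^sub>R a) \<le> p (x + s *\<^sub>R a) + p (y + t *\<^sub>R a)"
        using sublinear_add[OF p, of "x + s *\<^sub>R a" "y + t *\<^sub>R a"] by (simp add: algebra_simps)
      with le[of "s + t" "x + y"] s t
      show "q (x + y) - (p (y + t *\<^sub>R a) - t * p a) \<le> p (x + s *\<^sub>R a) - s * p a"
        by (simp add: algebra_simps)
    qed
    then have "q (x + y) - q x \<le> q y"
      by (intro ge) (simp add: algebra_simps)
    then show "q (x + y) \<le> q x + q y" by simp
  next
    fix r :: real and x assume r: "r > 0"
    have "inverse r * q (r *\<^sub>R x) \<le> q x"
    proof (rule ge)
      fix t :: real assume t: "t \<ge> 0"
      have "q (r *\<^sub>R x) \<le> p (r *\<^sub>R (x + t *\<^sub>R a)) - (r * t) * p a"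
        using le[of "r * t" "r *\<^sub>R x"] r t by (simp add: algebra_simps)
      also have "\<dots> = r * (p (x + t *\<^sub>R a) - t * p a)"
        using sublinear_scaleR[OF p, of r "x + t *\<^sub>R a"] r by (simp add: algebra_simps)
      finally show "inverse r * q (r *\<^sub>R x) \<le> p (x + t *\<^sub>R a) - t * p a"
        using r by (simp add: field_simps)
    qed
    then show "q (r *\<^sub>R x) \<le> r * q x"
      using r by (simp add: field_simps)
  next
    have "0 \<le> q 0"
      using sublinear_scaleR[OF p, of _ a] by (intro ge) simp
    then show "q 0 = 0"
      using qp[of 0] sublinear_zero[OF p] by simp
  qed
qed

text \<open>By \<open>sublinear_shift\<close>, a minimal sublinear functional is odd, hence linear.\<close>

lemma sublinear_dominates_linear:
  assumes p: "sublinear p"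
  obtains g where "linear g" "\<And>x. g x \<le> p x"
proof -
  define A where "A = {q. sublinear q \<and> q \<le> p}"
  \<comment> \<open>The order is reversed, so a maximal element in Zorn's lemma is a pointwise
    minimal sublinear functional below p.\<close>
  define P where "P = (\<lambda>q r. r \<le> (q :: 'a \<Rightarrow> real))"
  have "\<exists>q\<in>A. \<forall>r\<in>A. P q r \<longrightarrow> r = q"
  proof (rule predicate_Zorn)
    show "partial_order_on A (relation_of P A)"
      by (auto simp: partial_order_on_def preorder_on_def refl_on_def trans_def antisym_def
          relation_of_def P_def)
  next
    fix C assume C: "C \<in> Chains (relation_of P A)"
    show "\<exists>u\<in>A. \<forall>q\<in>C. P q u"
    proof (cases "C = {}")
      case True
      then show ?thesis using p by (auto simp: A_def)
    next
      case False
      have lin: "q \<le> r \<or> r \<le> q" if "q \<in> C" "r \<in> C" for q r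
        using C that by (auto simp: Chains_def relation_of_def P_def)
      define u where "u x = (INF q\<in>C. q x)" for x
      have CA: "sublinear q" "q \<le> p" if "q \<in> C" for q
        using C that by (auto simp: Chains_def relation_of_def A_def)
      have "- p (- x) \<le> q x" if "q \<in> C" for q x
        using sublinear_neg[OF CA(1)[OF that], of x] le_funD[OF CA(2)[OF that], of "- x"] by simp
      then have bdd: "bdd_below ((\<lambda>q. q x) ` C)" for x
        by (auto intro!: bdd_belowI)
      have le: "u x \<le> q x" if "q \<in> C" for q x
        unfolding u_def using that by (intro cINF_lower bdd)
      have ge: "c \<le> u x" if "\<And>q. q \<in> C \<Longrightarrow> c \<le> q x" for c x
        unfolding u_def using that False by (intro cINF_greatest)
      have "sublinear u"
      proof (rule sublinearI)
        fix x y
        have "u (x + y) - r y \<le> u x" if r: "r \<in> C" for r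
        proof (rule ge)
          fix q assume q: "q \<in> C"
          \<comment> \<open>One functional has to serve both summands: in a chain, the smaller of q
            and r does.\<close>
          have "u (x + y) \<le> q x + r y"
          proof (cases "q \<le> r")
            case True
            then show ?thesis
              using le[OF q, of "x + y"] sublinear_add[OF CA(1)[OF q], of x y] le_funD[OF True, of y]
              by simp
          next
            case False
            then have "r \<le> q" using lin[OF q r] by simp
            then show ?thesis
              using le[OF r, of "x + y"] sublinear_add[OF CA(1)[OF r], of x y] le_funD[of r q x]
              by simp
          qed
          then show "u (x + y) - r y \<le> q x" by simp
        qed
        then have "u (x + y) - u x \<le> u y"
          by (intro ge) (simp add: algebra_simps)
        then show "u (x + y) \<le> u x + u y" by simp
      next
        fix r :: real and x assume r: "r > 0"
        have "inverse r * u (r *\<^sub>R x) \<le> u x"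
        proof (rule ge)
          fix q assume q: "q \<in> C"
          show "inverse r * u (r *\<^sub>R x) \<le> q x"
            using le[OF q, of "r *\<^sub>R x"] sublinear_scaleR[OF CA(1)[OF q], of r x] r
            by (simp add: field_simps)
        qed
        then show "u (r *\<^sub>R x) \<le> r * u x"
          using r by (simp add: field_simps)
      next
        have "q 0 = 0" if "q \<in> C" for q
          using CA(1)[OF that] by (rule sublinear_zero)
        then show "u 0 = 0"
          using False le[of _ 0] ge[of 0 0] by fastforce
      qed
      moreover have "u \<le> p"
        using False le CA(2) by (metis (no_types, lifting) ex_in_conv le_fun_def order_trans)
      ultimately show ?thesis
        using le by (intro bexI[of _ u]) (auto simp: A_def P_def le_fun_def)
    qed
  qed
  then obtain g where g: "sublinear g" "g \<le> p" 
    and min: "\<And>r. sublinear r \<Longrightarrow> r \<le> g \<Longrightarrow> r = g"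
    by (auto simp: A_def P_def)
  have odd: "g (- a) = - g a" for a
  proof -
    obtain q where "sublinear q" "\<And>x. q x \<le> g x" "q (- a) \<le> - g a"
      using sublinear_shift[OF g(1)] by metis
    then have "g (- a) \<le> - g a"
      using min[of q] by (auto simp: le_fun_def)
    then show ?thesis
      using sublinear_neg[OF g(1), of a] by simp
  qed
  have "linear g"
  proof (rule linearI)
    fix x y
    show "g (x + y) = g x + g y"
      using sublinear_add[OF g(1), of x y] sublinear_add[OF g(1), of "- x" "- y"]
        odd[of "x + y"] odd[of x] odd[of y] by simp
  next
    fix r :: real and x
    show "g (r *\<^sub>R x) = r *\<^sub>R g x"
      using sublinear_scaleR[OF g(1), of r x] sublinear_scaleR[OF g(1), of "- r" x]
        odd[of "r *\<^sub>R x"] by (cases "r \<ge> 0") auto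
  qed
  then show ?thesis
    using g(2) that by (auto simp: le_fun_def)
qed

lemma complex_scale_i:
  fixes x :: "'a::complex_normed_vector"
  shows "c *\<^sub>C x = Re c *\<^sub>R x + Im c *\<^sub>R (\<i> *\<^sub>C x)"
proof -
  have "c *\<^sub>C x = (complex_of_real (Re c) + complex_of_real (Im c) * \<i>) *\<^sub>C x"
    by (rule arg_cong[where f = "\<lambda>c. c *\<^sub>C x"]) (simp add: complex_eq_iff)
  then show ?thesis
    by (simp only: scaleC_add_left scaleC_of_real flip: scaleC_scaleC)
qed

text \<open>Shifting the norm by \<open>sublinear_shift\<close> at x forces every linear minorant of
  the shifted functional to be at most \<open>- norm x\<close> at \<open>- x\<close>, hence nonzero
  at x. Such a minorant is then complexified.\<close>

theorem dual_space_separates_zero: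
  fixes x :: "'a::complex_normed_vector"
  assumes "x \<noteq> 0"
  obtains f where "f \<in> dual_space" "f x \<noteq> 0"
proof -
  have "sublinear (norm :: 'a \<Rightarrow> real)"
    by (simp add: sublinear_def norm_triangle_ineq)
  then obtain p where p: "sublinear p" "\<And>y. p y \<le> norm y" "p (- x) \<le> - norm x"
    using sublinear_shift by metis
  obtain g where g: "linear g" "\<And>y. g y \<le> p y"
    using sublinear_dominates_linear[OF p(1)] by metis
  have gx: "g x \<noteq> 0"
    using g(2)[of "- x"] p(3) linear_neg[OF g(1), of x] zero_less_norm_iff[of x] assms by linarith
  have gn: "\<bar>g y\<bar> \<le> norm y" for y
    using g(2)[of y] g(2)[of "- y"] p(2)[of y] p(2)[of "- y"] linear_neg[OF g(1), of y] by auto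
  interpret g: linear g by fact
  \<comment> \<open>Since g is only real linear, it is replaced by y |-> g(y) - i g(iy), the complex
    linear functional with real part g.\<close>
  define f where "f y = Complex (g y) (- g (\<i> *\<^sub>C y))" for y
  have ii: "\<i> *\<^sub>C \<i> *\<^sub>C y = - y" for y :: 'a
    using scaleC_of_real[of "- 1" y] by (simp add: scaleC_scaleC)
  have scR: "\<i> *\<^sub>C r *\<^sub>R y = r *\<^sub>R \<i> *\<^sub>C y" for r and y :: 'a
    by (simp add: scaleC_scaleC mult.commute flip: scaleC_of_real)
  have bl: "bounded_linear f"
  proof (rule bounded_linear_intro)
    show "f (y + z) = f y + f z" for y z
      by (simp add: f_def g.add scaleC_add_right complex_eq_iff)
    show "f (r *\<^sub>R y) = r *\<^sub>R f y" for r y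
      by (simp add: f_def g.scale scR complex_eq_iff)
    show "norm (f y) \<le> norm y * 2" for y
      using cmod_le[of "f y"] gn[of y] gn[of "\<i> *\<^sub>C y"] by (simp add: f_def norm_scaleC)
  qed
  have "f (c *\<^sub>C y) = c * f y" for c y
  proof -
    have icy: "\<i> *\<^sub>C c *\<^sub>C y = Re c *\<^sub>R (\<i> *\<^sub>C y) - Im c *\<^sub>R y"
      by (subst complex_scale_i) (simp add: scaleC_add_right scR ii)
    have "g (c *\<^sub>C y) = Re c * g y + Im c * g (\<i> *\<^sub>C y)"
      by (subst complex_scale_i) (simp add: g.add g.scale)
    moreover have "g (\<i> *\<^sub>C c *\<^sub>C y) = Re c * g (\<i> *\<^sub>C y) - Im c * g y"
      by (simp add: icy g.diff g.scale)
    ultimately show ?thesis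
      by (simp add: f_def complex_eq_iff algebra_simps)
  qed
  then have "f \<in> dual_space"
    using bl by (simp add: dual_space_def bounded_clinear_def scaleC_complex_def)
  moreover have "f x \<noteq> 0"
    using gx by (simp add: f_def complex_eq_iff)
  ultimately show ?thesis by (rule that)
qed

section \<open>Simons' inequality for decreasing sequences of convex classes\<close>

section \<open>Uniformly small convex combinations\<close>


text \<open>The argument of Simons' inequality: a series \<open>\<Sum>i. g\<^sub>i / 2 ^ i\<close>, whose terms are chosen in \<open>C i\<close>
  so as to nearly minimise the suprema of the partial sums, attains its supremum at a point where
  the functions in \<open>C n\<close> cannot become small.\<close>

lemma decreasing_convex_uniformly_small:
  fixes X :: "'a topology" and C :: "nat \<Rightarrow> ('a \<Rightarrow> real) set"
  assumes X: "compact_space X"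
    and ne: "\<And>n. C n \<noteq> {}"
    and dec: "\<And>n. C (Suc n) \<subseteq> C n"
    and conv: "\<And>n g h a. \<lbrakk>g \<in> C n; h \<in> C n; 0 \<le> a; a \<le> 1\<rbrakk> \<Longrightarrow> (\<lambda>x. a * g x + (1 - a) * h x) \<in> C n"
    and cont: "\<And>n g. g \<in> C n \<Longrightarrow> continuous_map X euclideanreal g"
    and bdd: "\<And>n g x. \<lbrakk>g \<in> C n; x \<in> topspace X\<rbrakk> \<Longrightarrow> 0 \<le> g x \<and> g x \<le> M"
    and lim: "\<And>x e. \<lbrakk>x \<in> topspace X; e > 0\<rbrakk> \<Longrightarrow> \<exists>n. \<forall>g\<in>C n. g x < e"
    and e: "e > 0"
  shows "\<exists>g\<in>C 0. \<forall>x\<in>topspace X. g x < e"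
proof (rule ccontr)
  assume neg: "\<not> ?thesis"
  then have big: "\<exists>x\<in>topspace X. e \<le> g x" if "g \<in> C 0" for g
    using that by (auto simp: not_less)
  then obtain x0 where x0: "x0 \<in> topspace X"
    using ne by blast
  have antimono: "C n \<subseteq> C k" if "k \<le> n" for n k
    using that dec by (rule lift_Suc_antimono_le[rotated])
  have M: "M \<ge> 0"
    using ne[of 0] bdd[OF _ x0] by (metis ex_in_conv order_trans)
  define S where "S h = (SUP x\<in>topspace X. h x)" for h :: "'a \<Rightarrow> real"
  have S_upper: "h x \<le> S h" if "\<And>x. x \<in> topspace X \<Longrightarrow> h x \<le> B" "x \<in> topspace X" for h B x
    unfolding S_def using that by (intro cSUP_upper) (auto intro!: bdd_aboveI)
  have S_least: "S h \<le> B" if "\<And>x. x \<in> topspace X \<Longrightarrow> h x \<le> B" for h B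
    unfolding S_def using that x0 by (intro cSUP_least) auto
  \<comment> \<open>These tolerances make the lower bound in \<open>incr\<close> reproduce itself
    exactly from n to n + 1.\<close>
  define d where "d n = e / (12 * 4 ^ n)" for n :: nat
  have d: "d n > 0" for n
    using e by (simp add: d_def)
  have near: "\<exists>g. g \<in> C n \<and> (\<forall>h\<in>C n. S (\<lambda>x. F x + g x / 2 ^ n) \<le> S (\<lambda>x. F x + h x / 2 ^ n) + d n)"
    if F: "\<And>x. x \<in> topspace X \<Longrightarrow> 0 \<le> F x \<and> F x \<le> 2 * M" for F n
  proof -
    define T where "T g = S (\<lambda>x. F x + g x / 2 ^ n)" for g
    have "0 \<le> T g" if g: "g \<in> C n" for g
    proof -
      have "F x + g x / 2 ^ n \<le> 2 * M + M / 2 ^ n" if "x \<in> topspace X" for x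
        using F[OF that] bdd[OF g that] by (intro add_mono divide_right_mono) auto
      then have "F x0 + g x0 / 2 ^ n \<le> T g"
        unfolding T_def using x0 by (rule S_upper)
      moreover have "0 \<le> F x0 + g x0 / 2 ^ n"
        using F[OF x0] bdd[OF g x0] by simp
      ultimately show ?thesis by simp
    qed
    then have b: "bdd_below (T ` C n)"
      by (auto intro!: bdd_belowI)
    have "Inf (T ` C n) < Inf (T ` C n) + d n"
      using d by simp
    then obtain g where g: "g \<in> C n" "T g < Inf (T ` C n) + d n"
      using cInf_lessD[of "T ` C n" "Inf (T ` C n) + d n"] ne[of n] by blast
    have "T g \<le> T h + d n" if "h \<in> C n" for h
      using g(2) cINF_lower[OF b that] by simp
    then show ?thesis
      using g(1) by (auto simp: T_def)
  qed
  \<comment> \<open>The choice depends only on n and the current partial sum F, so plain recursion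
    builds the series. It is a meaningful choice once F lies between 0 and 2M on X, which is shown
    next.\<close>
  define ch where "ch n F = (SOME g. g \<in> C n \<and>
      (\<forall>h\<in>C n. S (\<lambda>x. F x + g x / 2 ^ n) \<le> S (\<lambda>x. F x + h x / 2 ^ n) + d n))" for n F
  define G where "G = rec_nat (\<lambda>_. 0) (\<lambda>n F x. F x + ch n F x / 2 ^ n)"
  define g where "g n = ch n (G n)" for n
  have G0: "G 0 = (\<lambda>_. 0)" and GSuc: "G (Suc n) = (\<lambda>x. G n x + g n x / 2 ^ n)" for n
    by (simp_all add: G_def g_def)
  have ch: "g n \<in> C n \<and> (\<forall>h\<in>C n. S (G (Suc n)) \<le> S (\<lambda>x. G n x + h x / 2 ^ n) + d n)"
    if "\<And>x. x \<in> topspace X \<Longrightarrow> 0 \<le> G n x \<and> G n x \<le> 2 * M" for n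
    unfolding GSuc using someI_ex[OF near[of "G n" n, OF that]] by (simp add: g_def ch_def)
  \<comment> \<open>The sharper upper bound closes the induction: the next term is at most M / 2 ^
    n, half of the remaining gap to 2M.\<close>
  have "0 \<le> G n x \<and> G n x \<le> 2 * M - 2 * M / 2 ^ n" if "x \<in> topspace X" for n x
    using that
  proof (induction n arbitrary: x)
    case 0
    then show ?case by (simp add: G0)
  next
    case (Suc n)
    have "0 \<le> G n y \<and> G n y \<le> 2 * M" if "y \<in> topspace X" for y
      using Suc.IH[OF that] M by (smt (verit, best) divide_nonneg_nonneg zero_le_power)
    then have "g n \<in> C n"
      using ch by blast
    then have "0 \<le> g n x / 2 ^ n \<and> g n x / 2 ^ n \<le> M / 2 ^ n"
      using bdd[of "g n" n x] Suc.prems by (simp add: divide_right_mono)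
    then show ?case
      using Suc.IH[OF Suc.prems] by (simp add: GSuc)
  qed
  then have Gb: "0 \<le> G n x \<and> G n x \<le> 2 * M" if "x \<in> topspace X" for n x
    using that M by (smt (verit, best) divide_nonneg_nonneg zero_le_power)
  have gC: "g n \<in> C n" and gmin: "h \<in> C n \<Longrightarrow> S (G (Suc n)) \<le> S (\<lambda>x. G n x + h x / 2 ^ n) + d n"
    for n h using ch[OF Gb, of n] by auto
  have GS: "G n x \<le> S (G n)" if "x \<in> topspace X" for n x
    using Gb that by (intro S_upper) auto
  have step: "S (G (Suc (Suc n))) - S (G (Suc n)) \<ge> (S (G (Suc n)) - S (G n)) / 2 - 3 / 2 * d n" for n
  proof -
    \<comment> \<open>The weights 2/3 and 1/3 turn \<open>G n x + h x / 2 ^ n\<close> into one third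
      of \<open>G n x\<close> plus two thirds of \<open>G (Suc (Suc n)) x\<close>, so
      near-minimality of \<open>g n\<close> compares three consecutive suprema.\<close>
    define h where "h x = (2 / 3) * g n x + (1 - 2 / 3) * g (Suc n) x" for x
    have "h \<in> C n"
      unfolding h_def using gC[of n] gC[of "Suc n"] dec[of n] by (intro conv) auto
    then have "S (G (Suc n)) \<le> S (\<lambda>x. G n x + h x / 2 ^ n) + d n"
      by (rule gmin)
    also have "S (\<lambda>x. G n x + h x / 2 ^ n) \<le> S (G n) / 3 + 2 * S (G (Suc (Suc n))) / 3"
    proof (rule S_least)
      fix x assume x: "x \<in> topspace X"
      have "G n x + h x / 2 ^ n = G n x / 3 + 2 * G (Suc (Suc n)) x / 3"
        by (simp add: GSuc h_def field_simps)
      then show "G n x + h x / 2 ^ n \<le> S (G n) / 3 + 2 * S (G (Suc (Suc n))) / 3"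
        using GS[OF x, of n] GS[OF x, of "Suc (Suc n)"] by simp
    qed
    finally show ?thesis by (simp add: field_simps)
  qed
  \<comment> \<open>The first increment is at least e, and \<open>step\<close> lets increments halve
    up to a loss of \<open>3 / 2 * d n\<close>. The surplus \<open>e / 2 / 2 ^ n\<close> absorbs all
    losses, so the increments never fall below e / 2 / 2 ^ n.\<close>
  have incr: "S (G (Suc n)) - S (G n) \<ge> (e / 2 + e / 2 / 2 ^ n) / 2 ^ n" for n
  proof (induction n)
    case 0
    obtain x where "x \<in> topspace X" "e \<le> g 0 x"
      using big gC[of 0] by blast
    then have "e \<le> S (G (Suc 0))"
      using GS[of x "Suc 0"] by (simp add: GSuc G0)
    moreover have "S (G 0) \<le> 0"
      by (intro S_least) (simp add: G0)
    ultimately show ?case by simp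
  next
    case (Suc n)
    have "(e / 2 + e / 2 / 2 ^ n) / 2 ^ n / 2 - 3 / 2 * d n = (e / 2 + e / 2 / 2 ^ Suc n) / 2 ^ Suc n"
      by (simp add: d_def field_simps flip: power_mult_distrib)
    moreover have "(e / 2 + e / 2 / 2 ^ n) / 2 ^ n / 2 \<le> (S (G (Suc n)) - S (G n)) / 2"
      using Suc.IH by (intro divide_right_mono) simp_all
    ultimately show ?case
      using step[of n] by linarith
  qed
  have incr': "S (G (n + k)) - S (G n) \<ge> e / 2 ^ n - e / 2 ^ (n + k)" for n k
  proof (induction k)
    case (Suc k)
    have "e / 2 / 2 ^ (n + k) \<le> (e / 2 + e / 2 / 2 ^ (n + k)) / 2 ^ (n + k)"
      using e by (intro divide_right_mono) auto
    moreover have "e / 2 ^ (n + k) - e / 2 ^ (n + Suc k) = e / 2 / 2 ^ (n + k)"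
      by (simp add: field_simps)
    ultimately show ?case
      using incr[of "n + k"] Suc by simp
  qed simp
  define H where "H x = (\<Sum>i. g i x / 2 ^ i)" for x
  have Gsum: "G n x = (\<Sum>i<n. g i x / 2 ^ i)" for n x
    by (induction n) (simp_all add: G0 GSuc)
  have geo: "summable (\<lambda>i. c / 2 ^ i)" "(\<Sum>i. c / 2 ^ i) = 2 * c" for c :: real
    using summable_mult[OF summable_geometric[of "1 / 2 :: real"], of c]
      suminf_mult[OF summable_geometric[of "1 / 2 :: real"], of c] suminf_geometric[of "1 / 2 :: real"]
    by (simp_all add: power_divide)
  have summ: "summable (\<lambda>i. g i x / 2 ^ i)" if "x \<in> topspace X" for x
    using bdd[OF gC that] by (intro summable_comparison_test[OF _ geo(1)[of M]]) (auto intro!: divide_right_mono)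
  have tail: "0 \<le> H x - G n x \<and> H x - G n x \<le> 2 * c / 2 ^ n"
    if x: "x \<in> topspace X" and c: "\<And>i. i \<ge> n \<Longrightarrow> g i x \<le> c" for x n c
  proof -
    have s: "summable (\<lambda>i. g (i + n) x / 2 ^ (i + n))"
      using summ[OF x] by (simp add: summable_iff_shift[of "\<lambda>i. g i x / 2 ^ i" n])
    have eq: "H x - G n x = (\<Sum>i. g (i + n) x / 2 ^ (i + n))"
      using suminf_minus_initial_segment[OF summ[OF x], of n] by (simp add: H_def Gsum)
    have "(\<Sum>i. g (i + n) x / 2 ^ (i + n)) \<le> (\<Sum>i. c / 2 ^ n / 2 ^ i)"
    proof (rule suminf_le[OF _ s geo(1)])
      fix i show "g (i + n) x / 2 ^ (i + n) \<le> c / 2 ^ n / 2 ^ i"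
        using c[of "i + n"] by (simp add: power_add field_simps)
    qed
    moreover have "0 \<le> (\<Sum>i. g (i + n) x / 2 ^ (i + n))"
      using bdd[OF gC x] by (intro suminf_nonneg[OF s]) auto
    ultimately show ?thesis
      using geo(2)[of "c / 2 ^ n"] eq by simp
  qed
  have Gcont: "continuous_map X euclideanreal (G n)" for n
    by (induction n) (auto simp: G0 GSuc intro!: continuous_map_add continuous_map_real_divide cont[OF gC])
  \<comment> \<open>The tails are uniformly small, so H is continuous and attains its maximum on the
    compact space.\<close>
  have "continuous_map X Met_TC.mtopology H"
  proof (rule Met_TC.continuous_map_uniform_limit[where F = sequentially and f = G])
    fix \<epsilon> :: real assume "\<epsilon> > 0"
    have "(\<lambda>n. 2 * M * (1 / 2) ^ n) \<longlonglongrightarrow> 2 * M * 0"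
      by (intro tendsto_intros LIMSEQ_power_zero) simp
    then have "\<forall>\<^sub>F n in sequentially. 2 * M * (1 / 2) ^ n < \<epsilon>"
      using \<open>\<epsilon> > 0\<close> order_tendstoD(2) by fastforce
    then show "\<forall>\<^sub>F n in sequentially. \<forall>x\<in>topspace X. H x \<in> UNIV \<and> dist (G n x) (H x) < \<epsilon>"
    proof eventually_elim
      case (elim n)
      then show ?case
        using tail[of _ n M] bdd[OF gC] by (force simp: dist_real_def power_divide)
    qed
  qed (use Gcont in auto)
  then have "compactin euclideanreal (H ` topspace X)"
    using X by (intro image_compactin[of X]) (auto simp: compact_space_def)
  then have "\<exists>s\<in>H ` topspace X. \<forall>t\<in>H ` topspace X. t \<le> s"
    using x0 by (intro compact_attains_sup) auto
  then obtain y where y: "y \<in> topspace X" and ymax: "\<And>x. x \<in> topspace X \<Longrightarrow> H x \<le> H y"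
    by auto
  \<comment> \<open>At the maximum point y, the tail of H from n on is at most half of e / 2 ^ n. In
    the limit, \<open>incr'\<close> makes H y exceed \<open>S (G n)\<close>, and hence G n y, by at
    least e / 2 ^ n: a contradiction.\<close>
  obtain n where n: "\<And>h. h \<in> C n \<Longrightarrow> h y < e / 4"
    using lim[OF y, of "e / 4"] e by auto
  have SH: "S (G k) \<le> H y" for k
    using tail[of _ k M] bdd[OF gC] ymax by (intro S_least) (smt (verit, best))
  have "(\<lambda>k. e / 2 ^ n - e / 2 ^ n * (1 / 2) ^ k) \<longlonglongrightarrow> e / 2 ^ n - e / 2 ^ n * 0"
    by (intro tendsto_intros LIMSEQ_power_zero) simp
  then have "e / 2 ^ n - e / 2 ^ n * 0 \<le> H y - S (G n)"
  proof (rule LIMSEQ_le_const2)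
    show "\<exists>N. \<forall>k\<ge>N. e / 2 ^ n - e / 2 ^ n * (1 / 2) ^ k \<le> H y - S (G n)"
    proof (intro exI allI impI)
      fix k
      show "e / 2 ^ n - e / 2 ^ n * (1 / 2) ^ k \<le> H y - S (G n)"
        using incr'[of n k] SH[of "n + k"] by (simp add: power_add power_divide)
    qed
  qed
  moreover have "H y - G n y \<le> 2 * (e / 4) / 2 ^ n"
    using tail[OF y, of n "e / 4"] n gC antimono by (meson less_imp_le subsetD)
  moreover have "2 * (e / 4) / 2 ^ n < e / 2 ^ n"
    using e by (simp add: field_simps)
  ultimately show False
    using GS[OF y, of n] by simp
qed


section \<open>Eberlein's argument for separately continuous functions on compact spaces\<close>

lemma compact_space_cluster_point:
  fixes u :: "nat \<Rightarrow> 'a"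
  assumes X: "compact_space X" and u: "\<And>n. u n \<in> topspace X"
  obtains y where "\<And>N. y \<in> X closure_of (u ` {N..})"
proof -
  have "(\<Inter>n. X closure_of (u ` {n..})) \<noteq> {}"
  proof (rule compact_space_imp_nest[OF X])
    have "u ` {n..} \<subseteq> X closure_of (u ` {n..})" for n
      using u by (intro closure_of_subset) auto
    then show "X closure_of (u ` {n..}) \<noteq> {}" for n
      by auto
    show "decseq (\<lambda>n. X closure_of (u ` {n..}))"
      by (intro decseq_SucI closure_of_mono) auto
  qed auto
  then show ?thesis
    using that by blast
qed

text \<open>This replaces passing to the limit along nets: closed conditions survive at points of
  the closure.\<close>

lemma continuous_in_closure_of:
  fixes h :: "'a \<Rightarrow> real"
  assumes "y \<in> X closure_of A" "continuous_map X euclideanreal h" "closed B" "\<And>x. x \<in> A \<Longrightarrow> h x \<in> B"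
  shows "h y \<in> B"
proof (rule forall_in_closure_of[OF assms(1)])
  show "closedin X {x \<in> topspace X. h x \<in> B}"
    using assms(2,3) by (intro closedin_continuous_map_preimage) auto
qed (rule assms(4))

text \<open>Because U is finite, the points agreeing with d up to e on U form an open set
  \<open>W d\<close>. These sets cover X, and the centres of a finite subcover are the net.\<close>

lemma finite_net:
  fixes \<Phi> :: "'a \<Rightarrow> 'b \<Rightarrow> real"
  assumes X: "compact_space X" and U: "finite U" and e: "e > 0"
    and cont: "\<And>u. u \<in> U \<Longrightarrow> continuous_map X euclideanreal (\<lambda>x. \<Phi> x u)"
  obtains D where "finite D" "D \<subseteq> topspace X"
    "\<And>x. x \<in> topspace X \<Longrightarrow> \<exists>d\<in>D. \<forall>u\<in>U. \<bar>\<Phi> x u - \<Phi> d u\<bar> < e"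
proof -
  define W where "W d = topspace X \<inter> (\<Inter>u\<in>U. {x \<in> topspace X. \<Phi> x u \<in> {\<Phi> d u - e <..< \<Phi> d u + e}})" for d
  have "openin X (W d)" for d
    unfolding W_def
    by (intro openin_Int_Inter) (use U in \<open>auto intro!: openin_continuous_map_preimage[OF cont] simp del: greaterThanLessThan_iff\<close>)
  moreover have "topspace X \<subseteq> (\<Union>d\<in>topspace X. W d)"
    using e by (auto simp: W_def)
  ultimately obtain D where "finite D" "D \<subseteq> topspace X" "topspace X \<subseteq> (\<Union>d\<in>D. W d)"
    using X unfolding compact_space_alt
    by (smt (verit, best) finite_subset_image imageE)
  moreover have "\<forall>u\<in>U. \<bar>\<Phi> x u - \<Phi> d u\<bar> < e" if "x \<in> W d" for x d
    using that by (auto simp: W_def abs_less_iff)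
  ultimately have "finite D" "D \<subseteq> topspace X"
    "\<And>x. x \<in> topspace X \<Longrightarrow> \<exists>d\<in>D. \<forall>u\<in>U. \<bar>\<Phi> x u - \<Phi> d u\<bar> < e"
    by blast+
  then show ?thesis by (rule that)
qed

text \<open>Interleave the choice of \<open>u n\<close>, which makes \<open>\<Phi>\<close> small on the finite sets chosen so far, with the
  choice of finite sets that are ever finer nets for the functions \<open>\<Phi> _ (u i)\<close> chosen so far. If
  \<open>\<Phi> x (u n)\<close> did not tend to 0, a cluster point of the \<open>u n\<close> and one of the net points
  approximating \<open>x\<close> would contradict separate continuity.\<close>

lemma pointwise_null_sequence:
  fixes \<Phi> :: "'a \<Rightarrow> 'b \<Rightarrow> real"
  assumes X: "compact_space X" and Y: "compact_space Y"
    and contX: "\<And>u. u \<in> topspace Y \<Longrightarrow> continuous_map X euclideanreal (\<lambda>x. \<Phi> x u)"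
    and contY: "\<And>x. x \<in> topspace X \<Longrightarrow> continuous_map Y euclideanreal (\<Phi> x)"
    and A: "A \<subseteq> topspace Y" and u0: "u0 \<in> Y closure_of A"
    and zero: "\<And>x. x \<in> topspace X \<Longrightarrow> \<Phi> x u0 = 0"
  obtains u :: "nat \<Rightarrow> 'b" where "\<And>n. u n \<in> A" "\<And>x. x \<in> topspace X \<Longrightarrow> (\<lambda>n. \<Phi> x (u n)) \<longlonglongrightarrow> 0"
proof -
  \<comment> \<open>A state (U, D, u) consists of the points of A collected so far, the net points
    collected so far and the latest point u.\<close>
  let ?P = "\<lambda>n (U, D, u). finite U \<and> U \<subseteq> A \<and> finite D \<and> D \<subseteq> topspace X \<and> u \<in> A \<and> u \<in> U \<and>
      (\<forall>x\<in>topspace X. \<exists>d\<in>D. \<forall>v\<in>U. \<bar>\<Phi> x v - \<Phi> d v\<bar> < 1 / real (Suc n))"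
  let ?Q = "\<lambda>n (U, D, u) (U', D', u'). U \<subseteq> U' \<and> D \<subseteq> D' \<and> (\<forall>d\<in>D. \<bar>\<Phi> d u'\<bar> < 1 / real (Suc n))"
  have pick: "\<exists>s. ?P m s \<and> ?Q n (U, D, u) s"
    if U: "finite U" "U \<subseteq> A" and D: "finite D" "D \<subseteq> topspace X" for U D u n m
  proof -
    \<comment> \<open>A neighbourhood of u0, since \<Phi> vanishes there in the second argument; it
      therefore meets A.\<close>
    define W where "W = topspace Y \<inter> (\<Inter>d\<in>D. {v \<in> topspace Y. \<Phi> d v \<in> {- 1 / real (Suc n) <..< 1 / real (Suc n)}})"
    have "openin Y W"
      unfolding W_def using D
      by (intro openin_Int_Inter) (auto intro!: openin_continuous_map_preimage[OF contY] simp del: greaterThanLessThan_iff)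
    moreover have "u0 \<in> W"
      using u0 zero D by (auto simp: W_def in_closure_of subset_iff)
    ultimately obtain u' where u': "u' \<in> A" "u' \<in> W"
      using u0 by (auto simp: in_closure_of)
    have "finite (insert u' U)" using U by simp
    then obtain D' where "finite D'" "D' \<subseteq> topspace X"
      "\<And>x. x \<in> topspace X \<Longrightarrow> \<exists>d\<in>D'. \<forall>v\<in>insert u' U. \<bar>\<Phi> x v - \<Phi> d v\<bar> < 1 / real (Suc m)"
      using U A u' by (elim finite_net[OF X, where e = "1 / real (Suc m)" and \<Phi> = \<Phi>]) (auto intro!: contX)
    then show ?thesis
      using U D u'
      by (intro exI[of _ "(insert u' U, D \<union> D', u')"]) (fastforce simp: W_def abs_less_iff)
  qed
  have "\<exists>s. \<forall>n. ?P n (s n) \<and> ?Q n (s n) (s (Suc n))"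
  proof (rule dependent_nat_choice)
    show "\<exists>s. ?P 0 s"
      by (rule ex_forward[OF pick[of "{}" "{}" 0 0 undefined]]) simp_all
  next
    fix s n assume "?P n s"
    then show "\<exists>s'. ?P (Suc n) s' \<and> ?Q n s s'"
    proof (cases s)
      case (fields U D u)
      show ?thesis
        unfolding fields by (rule pick) (use \<open>?P n s\<close> fields in simp_all)
    qed
  qed
  then obtain s where s: "\<forall>n. ?P n (s n) \<and> ?Q n (s n) (s (Suc n))"
    by (rule exE)
  define U where "U n = fst (s n)" for n
  define D where "D n = fst (snd (s n))" for n
  define u where "u n = snd (snd (s n))" for n
  have P: "U n \<subseteq> A" "D n \<subseteq> topspace X" "u n \<in> A" "u n \<in> U n"
    "x \<in> topspace X \<Longrightarrow> \<exists>d\<in>D n. \<forall>v\<in>U n. \<bar>\<Phi> x v - \<Phi> d v\<bar> < 1 / real (Suc n)" for n x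
    using spec[OF s, of n] by (auto simp: U_def D_def u_def split: prod.splits)
  have Q: "U n \<subseteq> U (Suc n)" "D n \<subseteq> D (Suc n)" "d \<in> D n \<Longrightarrow> \<bar>\<Phi> d (u (Suc n))\<bar> < 1 / real (Suc n)" for n d
    using spec[OF s, of n] by (auto simp: U_def D_def u_def split: prod.splits)
  have Umono: "U m \<subseteq> U n" and Dmono: "D m \<subseteq> D n" if "m \<le> n" for m n
    using lift_Suc_mono_le[of U m n] lift_Suc_mono_le[of D m n] Q that by auto
  have small: "\<bar>\<Phi> d (u n)\<bar> < 1 / real n" if "d \<in> D m" "n > m" for d m n
  proof -
    obtain k where k: "n = Suc k" "m \<le> k"
      using \<open>n > m\<close> by (cases n) auto
    then show ?thesis
      using Q(3)[of d k] Dmono[of m k] that(1) by auto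
  qed
  have uY: "u n \<in> topspace Y" for n
    using P(3) A by blast
  have "(\<lambda>n. \<Phi> x (u n)) \<longlonglongrightarrow> 0" if x: "x \<in> topspace X" for x
  proof (rule ccontr)
    assume "\<not> ?thesis"
    then obtain \<delta> where \<delta>: "\<delta> > 0" "\<And>N. \<exists>n\<ge>N. \<delta> \<le> \<bar>\<Phi> x (u n)\<bar>"
      by (auto simp: LIMSEQ_def not_less)
    then obtain r where r: "\<And>N. r N \<ge> N" "\<And>N. \<delta> \<le> \<bar>\<Phi> x (u (r N))\<bar>"
      by metis
    obtain v where v: "\<And>N. v \<in> Y closure_of ((\<lambda>n. u (r n)) ` {N..})"
      using compact_space_cluster_point[OF Y, of "\<lambda>n. u (r n)"] uY by blast
    have vY: "v \<in> topspace Y"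
      using v[of 0] by (simp add: in_closure_of)
    \<comment> \<open>Net points d n approximating x on \<open>U n\<close> have a cluster point c.
      Then c and x give the same values at every \<open>u i\<close>, hence at v. But \<Phi> (d n) v
      = 0 for all n forces \<Phi> c v = 0, whereas \<Phi> x v has modulus at least \<delta>.\<close>
    have "\<forall>n. \<exists>d\<in>D n. \<forall>w\<in>U n. \<bar>\<Phi> x w - \<Phi> d w\<bar> < 1 / real (Suc n)"
      using P(5) x by blast
    then obtain d where d: "\<And>n. d n \<in> D n" "\<And>n w. w \<in> U n \<Longrightarrow> \<bar>\<Phi> x w - \<Phi> (d n) w\<bar> < 1 / real (Suc n)"
      by metis
    obtain c where c: "\<And>N. c \<in> X closure_of (d ` {N..})"
      using compact_space_cluster_point[OF X, of d] d(1) P(2) by blast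
    have cX: "c \<in> topspace X"
      using c[of 0] by (simp add: in_closure_of)
    have lim0: "a = 0" if "\<And>N. N > 0 \<Longrightarrow> \<bar>a\<bar> \<le> 1 / real N" for a
    proof (rule ccontr)
      assume "a \<noteq> 0"
      then obtain N where "0 < N" "1 / real N < \<bar>a\<bar>"
        using nat_approx_posE[of "\<bar>a\<bar>"] by (metis zero_less_Suc zero_less_abs_iff)
      with that[of N] show False by simp
    qed
    have "\<Phi> c (u i) = \<Phi> x (u i)" for i
    proof -
      have *: "\<Phi> c (u i) \<in> {\<Phi> x (u i) - 1 / real N .. \<Phi> x (u i) + 1 / real N}" if "N > 0" for N
      proof (rule continuous_in_closure_of[OF c contX[OF uY]])
        fix y assume "y \<in> d ` {max i N..}"
        then obtain n where n: "y = d n" "i \<le> n" "N \<le> n" by auto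
        have "\<bar>\<Phi> x (u i) - \<Phi> y (u i)\<bar> < 1 / real (Suc n)"
          using d(2)[of "u i" n] P(4)[of i] Umono[of i n] n by auto
        also have "\<dots> \<le> 1 / real N"
          using n that by (intro divide_left_mono) auto
        finally show "\<Phi> y (u i) \<in> {\<Phi> x (u i) - 1 / real N .. \<Phi> x (u i) + 1 / real N}"
          by (auto simp: abs_less_iff)
      qed auto
      have "\<bar>\<Phi> c (u i) - \<Phi> x (u i)\<bar> \<le> 1 / real N" if "N > 0" for N
        using *[OF that] unfolding atLeastAtMost_iff by linarith
      then show ?thesis using lim0[of "\<Phi> c (u i) - \<Phi> x (u i)"] by simp
    qed
    then have "\<Phi> c v - \<Phi> x v \<in> {0}"
      by (intro continuous_in_closure_of[OF v[of 0], where h = "\<lambda>v. \<Phi> c v - \<Phi> x v"])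
        (auto intro!: continuous_map_diff contY cX x)
    moreover have "\<Phi> c v \<in> {0}"
    proof (rule continuous_in_closure_of[OF c contX[OF vY]])
      fix y assume "y \<in> d ` {0..}"
      then obtain m where m: "y \<in> D m" using d(1) by auto
      have yX: "y \<in> topspace X" using m P(2) by blast
      have *: "\<Phi> y v \<in> {- 1 / real N .. 1 / real N}" if "N > 0" for N
      proof (rule continuous_in_closure_of[OF v contY[OF yX]])
        fix w assume "w \<in> (\<lambda>n. u (r n)) ` {Suc (max m N)..}"
        then obtain n where n: "w = u (r n)" "Suc (max m N) \<le> r n"
          using r(1) order_trans by blast
        have "\<bar>\<Phi> y w\<bar> < 1 / real (r n)"
          using small[OF m, of "r n"] n by simp
        also have "\<dots> \<le> 1 / real N"
          using n that by (intro divide_left_mono) auto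
        finally show "\<Phi> y w \<in> {- 1 / real N .. 1 / real N}"
          by (auto simp: abs_less_iff)
      qed auto
      have "\<bar>\<Phi> y v\<bar> \<le> 1 / real N" if "N > 0" for N
        using *[OF that] unfolding atLeastAtMost_iff by linarith
      then show "\<Phi> y v \<in> {0}"
        using lim0 by simp
    qed auto
    moreover have "\<bar>\<Phi> x v\<bar> \<in> {\<delta>..}"
      using r(2) by (intro continuous_in_closure_of[OF v[of 0], where h = "\<lambda>v. \<bar>\<Phi> x v\<bar>"])
        (auto intro!: continuous_map_real_abs contY x)
    ultimately show False
      using \<delta>(1) by simp
  qed
  with P(3) show ?thesis
    by (rule that)
qed

text \<open>Eberlein's sequence supplies pointwise convergence, which Simons' argument makes
  uniform. The abstract convex class C carries over to the small function g whatever the caller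
  knows about the individual functions, so no coefficients of convex combinations need to be
  recorded.\<close>

lemma uniformly_small_convex_combination:
  fixes \<Phi> :: "'a \<Rightarrow> 'b \<Rightarrow> real"
  assumes X: "compact_space X" and Y: "compact_space Y"
    and contX: "\<And>u. u \<in> topspace Y \<Longrightarrow> continuous_map X euclideanreal (\<lambda>x. \<Phi> x u)"
    and contY: "\<And>x. x \<in> topspace X \<Longrightarrow> continuous_map Y euclideanreal (\<Phi> x)"
    and bdd: "\<And>x u. \<lbrakk>x \<in> topspace X; u \<in> topspace Y\<rbrakk> \<Longrightarrow> 0 \<le> \<Phi> x u \<and> \<Phi> x u \<le> M"
    and A: "A \<subseteq> topspace Y" and u0: "u0 \<in> Y closure_of A"
    and zero: "\<And>x. x \<in> topspace X \<Longrightarrow> \<Phi> x u0 = 0"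
    and C: "\<And>u. u \<in> A \<Longrightarrow> (\<lambda>x. \<Phi> x u) \<in> C"
    and conv: "\<And>g h a. \<lbrakk>g \<in> C; h \<in> C; 0 \<le> a; a \<le> 1\<rbrakk> \<Longrightarrow> (\<lambda>x. a * g x + (1 - a) * h x) \<in> C"
    and e: "e > 0"
  shows "\<exists>g\<in>C. \<forall>x\<in>topspace X. g x < e"
proof -
  obtain u :: "nat \<Rightarrow> 'b" where u: "\<And>n. u n \<in> A" and lim: "\<And>x. x \<in> topspace X \<Longrightarrow> (\<lambda>n. \<Phi> x (u n)) \<longlonglongrightarrow> 0"
    using pointwise_null_sequence[OF X Y contX contY A u0 zero] by blast
  have uY: "u n \<in> topspace Y" for n
    using u A by blast
  \<comment> \<open>\<open>K n\<close> stands in for the convex hull of the functions with index k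
    \<ge> n: at each x its members obey every upper bound of that tail, which makes them small at x
    for large n.\<close>
  define K where "K n = {g \<in> C. continuous_map X euclideanreal g \<and>
      (\<forall>x\<in>topspace X. 0 \<le> g x \<and> g x \<le> M \<and> (\<forall>c. (\<forall>k\<ge>n. \<Phi> x (u k) \<le> c) \<longrightarrow> g x \<le> c))}" for n
  have "\<exists>g\<in>K 0. \<forall>x\<in>topspace X. g x < e"
  proof (rule decreasing_convex_uniformly_small[OF X, where M = M])
    show "K n \<noteq> {}" for n
      using C[OF u, of n] contX[OF uY, of n] bdd[OF _ uY, of _ n] by (auto simp: K_def)
    show "K (Suc n) \<subseteq> K n" for n
      by (auto simp: K_def)
    show "(\<lambda>x. a * g x + (1 - a) * h x) \<in> K n" if "g \<in> K n" "h \<in> K n" "0 \<le> a" "a \<le> 1" for n g h a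
    proof -
      have "a * g x + (1 - a) * h x \<le> c" if "g x \<le> c" "h x \<le> c" for x c
        using convex_bound_le[OF that, of a "1 - a"] \<open>0 \<le> a\<close> \<open>a \<le> 1\<close> by simp
      then show ?thesis
        using that conv[of g h a]
        by (auto simp: K_def intro!: continuous_map_add continuous_map_real_mult_left)
    qed
    show "\<exists>n. \<forall>g\<in>K n. g x < e" if x: "x \<in> topspace X" and "e > 0" for x e
    proof -
      obtain n where n: "\<And>k. k \<ge> n \<Longrightarrow> \<bar>\<Phi> x (u k)\<bar> < e / 2"
        using lim[OF x] \<open>e > 0\<close> by (metis LIMSEQ_D diff_zero half_gt_zero real_norm_def)
      have "g x < e" if "g \<in> K n" for g
      proof -
        have "\<forall>k\<ge>n. \<Phi> x (u k) \<le> e / 2"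
          using n by (metis abs_le_D1 less_imp_le)
        then have "g x \<le> e / 2"
          using that x unfolding K_def by blast
        then show ?thesis using \<open>e > 0\<close> by simp
      qed
      then show ?thesis by blast
    qed
  qed (auto simp: K_def e)
  then show ?thesis
    by (auto simp: K_def)
qed

section \<open>Stability properties of weakly almost periodic functions\<close>

section \<open>Weak topologies and weakly almost periodic functions\<close>


lemma bounded_clinear_comp:
  "bounded_clinear u \<Longrightarrow> bounded_clinear v \<Longrightarrow> bounded_clinear (u \<circ> v)"
  by (auto simp: bounded_clinear_def bounded_linear_compose o_def)

lemma bounded_clinear_diff: "bounded_clinear u \<Longrightarrow> u (x - y) = u x - u y"
  by (simp add: bounded_clinear_def bounded_linear.linear linear_diff)

lemma bounded_clinear_add: "bounded_clinear u \<Longrightarrow> u (x + y) = u x + u y"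
  by (simp add: bounded_clinear_def bounded_linear.linear linear_add)

lemma bounded_clinear_zero: "bounded_clinear u \<Longrightarrow> u 0 = 0"
  by (simp add: bounded_clinear_def bounded_linear.linear linear_0)

lemma dual_space_comp: "f \<in> dual_space \<Longrightarrow> bounded_clinear u \<Longrightarrow> f \<circ> u \<in> dual_space"
  by (simp add: dual_space_def bounded_clinear_comp)

text \<open>The weak topology is initial for the functionals in \<open>dual_space\<close>, so
  preimages of the generating sets suffice.\<close>

lemma continuous_map_weak_topology_iff:
  "continuous_map X weak_topology F \<longleftrightarrow> (\<forall>f\<in>dual_space. continuous_map X euclidean (\<lambda>x. f (F x)))"
proof safe
  fix f :: "'b \<Rightarrow> complex" assume F: "continuous_map X weak_topology F" and f: "f \<in> dual_space"
  have "openin weak_topology {x. f x \<in> U}" if "open U" for U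
    unfolding weak_topology_def using f that by (intro topology_generated_by_Basis) auto
  then have "continuous_map weak_topology euclidean f"
    by (simp add: continuous_map)
  then show "continuous_map X euclidean (\<lambda>x. f (F x))"
    using continuous_map_compose[OF F] by (simp add: o_def)
next
  assume *: "\<forall>f\<in>dual_space. continuous_map X euclidean (\<lambda>x. f (F x))"
  show "continuous_map X weak_topology F"
    unfolding weak_topology_def
  proof (rule continuous_on_generated_topo)
    fix V assume "V \<in> {{x. f x \<in> U} |(f :: 'b \<Rightarrow> complex) U. f \<in> dual_space \<and> open U}"
    then obtain f :: "'b \<Rightarrow> complex" and U where fU: "V = {x. f x \<in> U}" "f \<in> dual_space" "open U"
      by auto
    have "openin X {x \<in> topspace X. f (F x) \<in> U}"
      using * fU by (intro openin_continuous_map_preimage[where Y = euclidean]) auto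
    then show "openin X (F -` V \<inter> topspace X)"
      by (simp add: fU(1) vimage_def Int_def conj_commute)
  next
    show "F ` topspace X \<subseteq> \<Union> {{x. f x \<in> U} |(f :: 'b \<Rightarrow> complex) U. f \<in> dual_space \<and> open U}"
      using topspace_weak_topology[where 'a = 'b]
      unfolding weak_topology_def topology_generated_by_topspace by simp
  qed
qed

lemma continuous_map_dual_space: "f \<in> dual_space \<Longrightarrow> continuous_map weak_topology euclidean f"
  using continuous_map_weak_topology_iff[of weak_topology "\<lambda>x. x"] by auto

lemma continuous_map_weak_topology_bounded_clinear:
  "bounded_clinear u \<Longrightarrow> continuous_map weak_topology weak_topology u"
  using continuous_map_dual_space[OF dual_space_comp]
  by (auto simp: continuous_map_weak_topology_iff o_def)

lemma Hausdorff_weak_topology: "Hausdorff_space (weak_topology :: 'a::complex_normed_vector topology)"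
  unfolding Hausdorff_space_def
proof (intro allI impI, elim conjE)
  fix x y :: 'a assume "x \<noteq> y"
  then obtain f where f: "f \<in> dual_space" "f (x - y) \<noteq> 0"
    using dual_space_separates_zero[of "x - y"] by auto
  then have "f x \<noteq> f y"
    by (simp add: dual_space_def bounded_clinear_diff)
  then obtain U V where UV: "open U" "open V" "f x \<in> U" "f y \<in> V" "U \<inter> V = {}"
    using hausdorff by meson
  have "openin weak_topology {z. f z \<in> W}" if "open W" for W
    using openin_continuous_map_preimage[OF continuous_map_dual_space[OF f(1)], of W] that by simp
  with UV show "\<exists>U V. openin weak_topology U \<and> openin weak_topology V \<and> x \<in> U \<and> y \<in> V \<and> disjnt U V"
    by (intro exI[of _ "{z. f z \<in> U}"] exI[of _ "{z. f z \<in> V}"]) (auto simp: disjnt_def)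
qed

lemma relatively_compact_in_Hausdorff:
  assumes "Hausdorff_space T" "compactin T K" "A \<subseteq> K"
  shows "relatively_compact_in T A"
  unfolding relatively_compact_in_def
proof
  show "A \<subseteq> topspace T"
    using assms compactin_subset_topspace by blast
  have "T closure_of A \<subseteq> K"
    using assms by (intro closure_of_minimal compactin_imp_closedin)
  then show "compactin T (T closure_of A)"
    using assms(2) by (intro closed_compactin[OF assms(2)]) auto
qed

text \<open>The weak topology being Hausdorff, any compact set containing the orbit will do.
  Membership in \<open>wap\<close> thus passes through continuous images of compact sets, with no
  closures to compute.\<close>

lemma wap_iff:
  "f \<in> wap \<longleftrightarrow> (\<exists>K. compactin weak_topology K \<and> range (\<lambda>s. right_translate s f) \<subseteq> K)"
proof
  assume "f \<in> wap"
  then show "\<exists>K. compactin weak_topology K \<and> range (\<lambda>s. right_translate s f) \<subseteq> K"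
    unfolding wap_def relatively_compact_in_def mem_Collect_eq
    by (blast intro: closure_of_subset[THEN subsetD])
qed (auto simp: wap_def intro: relatively_compact_in_Hausdorff[OF Hausdorff_weak_topology])

lemma wap_image:
  assumes f: "f \<in> wap" and T: "continuous_map weak_topology weak_topology T"
    and comm: "\<And>s. right_translate s (T f) = T (right_translate s f)"
  shows "T f \<in> wap"
proof -
  obtain K where K: "compactin weak_topology K" "range (\<lambda>s. right_translate s f) \<subseteq> K"
    using f by (auto simp: wap_iff)
  show ?thesis
    unfolding wap_iff comm using K by (intro exI[of _ "T ` K"]) (auto intro: image_compactin T)
qed

lemma wap_add:
  fixes f g :: "'s::semitopological_semigroup \<Rightarrow>\<^sub>C complex"
  assumes "f \<in> wap" "g \<in> wap"
  shows "f + g \<in> wap"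
proof -
  obtain K L where K: "compactin weak_topology K" "range (\<lambda>s. right_translate s f) \<subseteq> K"
    and L: "compactin weak_topology L" "range (\<lambda>s. right_translate s g) \<subseteq> L"
    using assms by (auto simp: wap_iff)
  let ?W = "weak_topology :: ('s \<Rightarrow>\<^sub>C complex) topology"
  \<comment> \<open>Addition is jointly continuous for the weak topology, so the sum of the compact
    sets K and L is compact.\<close>
  have "continuous_map (prod_topology ?W ?W) weak_topology (\<lambda>z. fst z + snd z)"
    unfolding continuous_map_weak_topology_iff
  proof
    fix \<phi> :: "('s \<Rightarrow>\<^sub>C complex) \<Rightarrow> complex" assume \<phi>: "\<phi> \<in> dual_space"
    have "continuous_map (prod_topology ?W ?W) euclidean (\<lambda>z. \<phi> (fst z) + \<phi> (snd z))"
      using continuous_map_dual_space[OF \<phi>]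
      by (intro continuous_map_add) (auto intro: continuous_map_compose[unfolded o_def] continuous_map_fst continuous_map_snd)
    then show "continuous_map (prod_topology ?W ?W) euclidean (\<lambda>z. \<phi> (fst z + snd z))"
      using \<phi> by (simp add: dual_space_def bounded_clinear_add)
  qed
  then have "compactin weak_topology ((\<lambda>z. fst z + snd z) ` (K \<times> L))"
    using K L by (intro image_compactin[where X = "prod_topology ?W ?W"]) (auto simp: compactin_Times)
  moreover have "right_translate s (f + g) = right_translate s f + right_translate s g" for s
    by (rule bcontfun_eqI) (simp add: right_translate.rep_eq plus_bcontfun.rep_eq)
  ultimately show ?thesis
    unfolding wap_iff using K L by (intro exI[of _ "(\<lambda>z. fst z + snd z) ` (K \<times> L)"]) force
qed

lemma bounded_clinear_scaleC: "bounded_clinear (\<lambda>x::'a::complex_normed_vector. c *\<^sub>C x)"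
  unfolding bounded_clinear_def
proof (intro conjI allI bounded_linear_intro)
  fix r :: real and d x
  show com: "c *\<^sub>C d *\<^sub>C x = d *\<^sub>C c *\<^sub>C x" for d and x :: 'a
    by (simp add: scaleC_scaleC mult.commute)
  show "c *\<^sub>C r *\<^sub>R x = r *\<^sub>R c *\<^sub>C x" for x :: 'a
    using com[of "complex_of_real r" x] by (simp add: scaleC_of_real)
  show "norm (c *\<^sub>C x) \<le> norm x * cmod c" for x :: 'a
    by (simp add: norm_scaleC mult.commute)
qed (rule scaleC_add_right)

lemma wap_scaleC:
  assumes "f \<in> wap"
  shows "c *\<^sub>C f \<in> wap"
proof (rule wap_image[OF assms])
  show "continuous_map weak_topology weak_topology (\<lambda>f. c *\<^sub>C f)"
    by (intro continuous_map_weak_topology_bounded_clinear bounded_clinear_scaleC)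
  show "right_translate s (c *\<^sub>C f) = c *\<^sub>C right_translate s f" for s
    by (rule bcontfun_eqI) (simp add: right_translate.rep_eq scaleC_bcontfun.rep_eq)
qed

lemma wap_scaleR: "f \<in> wap \<Longrightarrow> r *\<^sub>R f \<in> wap"
  using wap_scaleC[of f "complex_of_real r"] by (simp add: scaleC_of_real)

lemma wap_const: "const_bcontfun c \<in> wap"
proof -
  have "right_translate s (const_bcontfun c) = const_bcontfun c" for s
    by (rule bcontfun_eqI) (simp add: right_translate.rep_eq const_bcontfun.rep_eq)
  then show ?thesis
    unfolding wap_iff by (intro exI[of _ "{const_bcontfun c}"]) auto
qed

lift_definition cnj_bcontfun :: "('s::topological_space \<Rightarrow>\<^sub>C complex) \<Rightarrow> ('s \<Rightarrow>\<^sub>C complex)"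
  is "\<lambda>f x. cnj (f x)"
  by (auto simp: bcontfun_def bounded_iff intro!: continuous_intros)

lemma wap_cnj:
  fixes f :: "'s::semitopological_semigroup \<Rightarrow>\<^sub>C complex"
  assumes "f \<in> wap"
  shows "cnj_bcontfun f \<in> wap"
proof (rule wap_image[OF assms])
  show "right_translate s (cnj_bcontfun f) = cnj_bcontfun (right_translate s f)" for s
    by (rule bcontfun_eqI) (simp add: right_translate.rep_eq cnj_bcontfun.rep_eq)
  show "continuous_map weak_topology weak_topology (cnj_bcontfun :: ('s \<Rightarrow>\<^sub>C complex) \<Rightarrow> _)"
    unfolding continuous_map_weak_topology_iff
  proof
    fix \<phi> :: "('s \<Rightarrow>\<^sub>C complex) \<Rightarrow> complex" assume \<phi>: "\<phi> \<in> dual_space"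
    then obtain B where B: "norm (\<phi> g) \<le> norm g * B" for g
      using bounded_linear.bounded[of \<phi>] by (auto simp: dual_space_def bounded_clinear_def)
    \<comment> \<open>Conjugation is conjugate linear, so composing it with \<phi> leaves the dual;
      conjugating the result once more restores complex linearity.\<close>
    define \<psi> where "\<psi> g = cnj (\<phi> (cnj_bcontfun g))" for g
    have cadd: "cnj_bcontfun (g + h) = cnj_bcontfun g + cnj_bcontfun h" for g h :: "'s \<Rightarrow>\<^sub>C complex"
      by (rule bcontfun_eqI) (simp add: cnj_bcontfun.rep_eq plus_bcontfun.rep_eq)
    have cscaleC: "cnj_bcontfun (c *\<^sub>C g) = cnj c *\<^sub>C cnj_bcontfun g" for c and g :: "'s \<Rightarrow>\<^sub>C complex"
      by (rule bcontfun_eqI) (simp add: cnj_bcontfun.rep_eq scaleC_bcontfun.rep_eq scaleC_complex_def)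
    have cnorm: "norm (cnj_bcontfun g) \<le> norm g" for g :: "'s \<Rightarrow>\<^sub>C complex"
      by (rule norm_bound) (simp add: cnj_bcontfun.rep_eq norm_bounded)
    have lin: "\<psi> (c *\<^sub>C g) = c * \<psi> g" for c g
      using \<phi> by (simp add: \<psi>_def cscaleC dual_space_def bounded_clinear_def scaleC_complex_def)
    have "bounded_linear \<psi>"
    proof (rule bounded_linear_intro)
      show "\<psi> (g + h) = \<psi> g + \<psi> h" for g h
        using \<phi> by (simp add: \<psi>_def cadd dual_space_def bounded_clinear_add)
      show "\<psi> (r *\<^sub>R g) = r *\<^sub>R \<psi> g" for r g
        using lin[of "complex_of_real r" g] by (simp add: scaleC_of_real scaleR_conv_of_real)
      show "norm (\<psi> g) \<le> norm g * \<bar>B\<bar>" for g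
      proof -
        have "norm (\<psi> g) \<le> norm (cnj_bcontfun g) * \<bar>B\<bar>"
          unfolding \<psi>_def complex_mod_cnj
          by (rule order_trans[OF B]) (intro mult_left_mono abs_ge_self norm_ge_zero)
        also have "\<dots> \<le> norm g * \<bar>B\<bar>"
          by (intro mult_right_mono cnorm) simp
        finally show ?thesis .
      qed
    qed
    then have "\<psi> \<in> dual_space"
      using lin by (simp add: dual_space_def bounded_clinear_def scaleC_complex_def)
    then have "continuous_map weak_topology euclidean (\<lambda>g. cnj (\<psi> g))"
      using continuous_map_compose[OF continuous_map_dual_space, of \<psi> euclidean cnj]
      by (simp add: o_def continuous_on_cnj continuous_on_id)
    then show "continuous_map weak_topology euclidean (\<lambda>g. \<phi> (cnj_bcontfun g))"
      by (simp add: \<psi>_def)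
  qed
qed

text \<open>A mean is normalised by its norm, not by its value at 1. If that value were 0,
  positivity at the constant \<open>norm h\<close> plus or minus h would give m h = 0 for every real
  h, so m would vanish on \<open>wap\<close>.\<close>

lemma bi_invariant_mean_one_nonzero:
  fixes m :: "('s::semitopological_semigroup \<Rightarrow>\<^sub>C complex) \<Rightarrow> complex"
  assumes m: "bi_invariant_mean m"
  shows "m (const_bcontfun 1) \<noteq> 0"
proof
  assume one: "m (const_bcontfun 1) = 0"
  have madd: "m (f + g) = m f + m g" if "f \<in> wap" "g \<in> wap" for f g
    using m that by (simp add: bi_invariant_mean_def)
  have mscale: "m (c *\<^sub>C f) = c * m f" if "f \<in> wap" for c f
    using m that by (simp add: bi_invariant_mean_def)
  have mpos: "m f \<in> \<real>\<^sub>\<ge>\<^sub>0" if "f \<in> wap" "\<And>t. apply_bcontfun f t \<in> \<real>\<^sub>\<ge>\<^sub>0" for f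
    using m that by (auto simp: bi_invariant_mean_def)
  have real: "m h = 0" if h: "h \<in> wap" and hR: "\<And>t. apply_bcontfun h t \<in> \<real>" for h
  proof -
    define N where "N = (const_bcontfun (complex_of_real (norm h)) :: 's \<Rightarrow>\<^sub>C complex)"
    have Nw: "N \<in> wap" by (simp add: N_def wap_const)
    have "N = complex_of_real (norm h) *\<^sub>C const_bcontfun 1"
      by (rule bcontfun_eqI) (simp add: N_def const_bcontfun.rep_eq scaleC_bcontfun.rep_eq scaleC_complex_def)
    then have N0: "m N = 0"
      using mscale[OF wap_const, of "complex_of_real (norm h)" 1] one by simp
    have "m (N + c *\<^sub>C h) \<in> \<real>\<^sub>\<ge>\<^sub>0" if c: "c = 1 \<or> c = -1" for c
    proof (rule mpos)
      show "N + c *\<^sub>C h \<in> wap" by (intro wap_add wap_scaleC Nw h)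
      fix t
      obtain r where r: "apply_bcontfun h t = complex_of_real r"
        using hR[of t] by (auto simp: Reals_def)
      have "\<bar>r\<bar> \<le> norm h"
        using norm_bounded[of h t] r by simp
      then show "apply_bcontfun (N + c *\<^sub>C h) t \<in> \<real>\<^sub>\<ge>\<^sub>0"
        using c by (auto simp: r N_def plus_bcontfun.rep_eq const_bcontfun.rep_eq
            scaleC_bcontfun.rep_eq scaleC_complex_def complex_nonneg_Reals_iff)
    qed
    from this[of 1] this[of "-1"] show ?thesis
      by (simp add: madd Nw h wap_scaleC mscale N0 complex_nonneg_Reals_iff complex_eq_iff)
  qed
  have zero: "m f = 0" if f: "f \<in> wap" for f
  proof -
    define h where "h = (1/2) *\<^sub>C (f + cnj_bcontfun f)"
    define k where "k = (- \<i>/2) *\<^sub>C (f + (-1) *\<^sub>C cnj_bcontfun f)"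
    have hk: "h \<in> wap" "k \<in> wap"
      unfolding h_def k_def by (intro wap_scaleC wap_add wap_cnj f)+
    have "f = h + \<i> *\<^sub>C k"
      by (rule bcontfun_eqI) (simp add: h_def k_def plus_bcontfun.rep_eq scaleC_bcontfun.rep_eq
          scaleC_complex_def cnj_bcontfun.rep_eq field_simps)
    then have "m f = m h + \<i> * m k"
      using hk by (simp add: madd mscale wap_scaleC)
    moreover have "m h = 0" "m k = 0"
      by (intro real hk, simp add: h_def k_def plus_bcontfun.rep_eq scaleC_bcontfun.rep_eq
          scaleC_complex_def cnj_bcontfun.rep_eq complex_is_Real_iff)+
    ultimately show ?thesis by simp
  qed
  \<comment> \<open>The zero function shows that the supremum defining the norm is taken over {0}
    and not over the empty set.\<close>
  have "(0 :: 's \<Rightarrow>\<^sub>C complex) \<in> {f\<in>wap. norm f \<le> 1}"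
    using wap_scaleR[OF wap_const, of 0] by simp
  then have "(\<lambda>f. cmod (m f)) ` {f\<in>wap. norm f \<le> 1} = {0}"
    using zero by (auto intro!: image_eqI[where x = 0])
  then show False
    using m by (simp add: bi_invariant_mean_def)
qed

section \<open>The compact semigroup of operators in the closure of the representation\<close>

section \<open>Relatively weakly compact representations\<close>


lemma continuous_map_weak_operator_topologyI:
  assumes "\<And>x. x \<in> topspace X \<Longrightarrow> bounded_clinear (F x)"
    and "\<And>f \<xi>. f \<in> dual_space \<Longrightarrow> continuous_map X euclidean (\<lambda>x. f (F x \<xi>))"
  shows "continuous_map X weak_operator_topology (F :: 'b \<Rightarrow> 'a::complex_banach \<Rightarrow> 'a)"
  unfolding weak_operator_topology_def
proof (rule continuous_on_generated_topo)
  fix V assume "V \<in> {{u :: 'a \<Rightarrow> 'a. bounded_clinear u \<and> f (u x) \<in> U} |x f U. f \<in> dual_space \<and> open U}"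
  then obtain \<xi> f U where V: "V = {u :: 'a \<Rightarrow> 'a. bounded_clinear u \<and> f (u \<xi>) \<in> U}" "f \<in> dual_space" "open U"
    by auto
  have "openin X {x \<in> topspace X. f (F x \<xi>) \<in> U}"
    using V by (intro openin_continuous_map_preimage[OF assms(2)]) auto
  also have "{x \<in> topspace X. f (F x \<xi>) \<in> U} = F -` V \<inter> topspace X"
    using V(1) assms(1) by auto
  finally show "openin X (F -` V \<inter> topspace X)" .
next
  show "F ` topspace X \<subseteq> \<Union> {{u :: 'a \<Rightarrow> 'a. bounded_clinear u \<and> f (u x) \<in> U} |x f U. f \<in> dual_space \<and> open U}"
    using topspace_weak_operator_topology[where 'a = 'a] assms(1)
    unfolding weak_operator_topology_def topology_generated_by_topspace by auto
qed

lemma continuous_map_comp_left: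
  "bounded_clinear w \<Longrightarrow> continuous_map weak_operator_topology weak_operator_topology (\<lambda>u. w \<circ> u)"
  using continuous_map_coefficient[OF dual_space_comp]
  by (intro continuous_map_weak_operator_topologyI) (auto simp: bounded_clinear_comp)

lemma continuous_map_comp_right:
  "bounded_clinear w \<Longrightarrow> continuous_map weak_operator_topology weak_operator_topology (\<lambda>u. u \<circ> w)"
  by (intro continuous_map_weak_operator_topologyI) (auto simp: bounded_clinear_comp intro: continuous_map_coefficient)

context
  fixes \<pi> :: "'s::semitopological_semigroup \<Rightarrow> 'e::complex_banach \<Rightarrow> 'e"
  assumes rep: "relatively_weakly_compact_rep \<pi>"
begin

abbreviation (input) \<S> :: "('e \<Rightarrow> 'e) set"
  where "\<S> \<equiv> weak_operator_topology closure_of (range \<pi>)"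

lemma range_subset_closure: "range \<pi> \<subseteq> \<S>"
  using rep by (auto simp: relatively_weakly_compact_rep_def relatively_compact_in_def
      intro!: closure_of_subset[THEN subsetD])

lemma rep_in_closure: "\<pi> s \<in> \<S>"
  using range_subset_closure by blast

lemma rep_mult: "\<pi> (s * t) = \<pi> s \<circ> \<pi> t"
  using rep by (simp add: relatively_weakly_compact_rep_def representation_def)

lemma bounded_clinear_closure: "u \<in> \<S> \<Longrightarrow> bounded_clinear u"
  using closure_of_subset_topspace[of weak_operator_topology "range \<pi>"] by auto

lemma compact_closure: "compactin weak_operator_topology \<S>"
  using rep by (simp add: relatively_weakly_compact_rep_def relatively_compact_in_def)

lemma compact_space_closure: "compact_space (subtopology weak_operator_topology \<S>)"
  by (intro compact_space_subtopology compact_closure)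

lemma topspace_closure: "topspace (subtopology weak_operator_topology \<S>) = \<S>"
  using closure_of_subset_topspace[of weak_operator_topology "range \<pi>"] by auto

text \<open>Composition is only separately continuous, so one factor at a time moves into the
  closure: first the right one, with \<open>\<pi> s\<close> on the left, then the left one.\<close>

lemma closure_comp:
  assumes "u \<in> \<S>" "v \<in> \<S>"
  shows "u \<circ> v \<in> \<S>"
proof -
  have step: "F w \<in> \<S>" if F: "continuous_map weak_operator_topology weak_operator_topology F"
    and sub: "F ` range \<pi> \<subseteq> \<S>" and w: "w \<in> \<S>" for F w
  proof -
    have "F w \<in> weak_operator_topology closure_of (F ` range \<pi>)"
      using continuous_map_image_closure_subset[OF F] w by blast
    also have "\<dots> \<subseteq> \<S>"
      using sub by (intro closure_of_minimal) auto
    finally show ?thesis .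
  qed
  have "\<pi> s \<circ> w \<in> \<S>" if "w \<in> \<S>" for s w
  proof (rule step[OF _ _ that])
    show "continuous_map weak_operator_topology weak_operator_topology (\<lambda>w. \<pi> s \<circ> w)"
      by (intro continuous_map_comp_left bounded_clinear_closure rep_in_closure)
    show "(\<lambda>w. \<pi> s \<circ> w) ` range \<pi> \<subseteq> \<S>"
      using rep_in_closure by (auto simp flip: rep_mult)
  qed
  then show ?thesis
    using assms by (intro step[where F = "\<lambda>u. u \<circ> v"] continuous_map_comp_right bounded_clinear_closure) auto
qed

lemma coefficient_bounded:
  assumes "f \<in> dual_space"
  obtains b where "b \<ge> 0" "\<And>u. u \<in> \<S> \<Longrightarrow> cmod (f (u \<xi>)) \<le> b"
proof -
  have "compactin euclidean ((\<lambda>u. f (u \<xi>)) ` \<S>)"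
    by (rule image_compactin[OF compact_closure continuous_map_coefficient[OF assms]])
  then have "bounded ((\<lambda>u. f (u \<xi>)) ` \<S>)"
    by (simp add: compact_imp_bounded)
  then obtain b where "\<forall>x\<in>(\<lambda>u. f (u \<xi>)) ` \<S>. cmod x \<le> b"
    unfolding bounded_iff ..
  then have b: "cmod (f (u \<xi>)) \<le> b" if "u \<in> \<S>" for u
    using that by blast
  show ?thesis
    \<comment> \<open>An arbitrary semigroup element serves here only to show b \<ge> 0.\<close>
    using b rep_in_closure[of undefined] by (intro that[of b]) (auto intro: order_trans[OF norm_ge_zero])
qed

section \<open>Weak almost periodicity of the coefficient powers\<close>

lemma continuous_map_coefficient_powr:
  assumes "f \<in> dual_space" "p > 0"
  shows "continuous_map (subtopology weak_operator_topology \<S>) euclideanreal (\<lambda>u. \<bar>cmod (f (u \<xi>)) powr p - c\<bar>)"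
proof -
  have "continuous_on UNIV (\<lambda>z. \<bar>cmod z powr p - c\<bar>)"
    by (intro continuous_intros continuous_on_powr') (use assms(2) in auto)
  then have "continuous_map euclidean euclideanreal (\<lambda>z. \<bar>cmod z powr p - c\<bar>)"
    by simp
  from continuous_map_compose[OF continuous_map_coefficient[OF assms(1)] this]
  show ?thesis
    by (intro continuous_map_from_subtopology) (simp add: o_def)
qed

text \<open>Both variables range over the compact set \<open>\<S>\<close>. The value f(v(u \<xi>))
  is a coefficient of v at the vector \<open>u \<xi>\<close> and a coefficient of u for the
  functional \<open>f \<circ> v\<close>, hence separately continuous.\<close>

lemma coefficient_powr_convex_combination:
  assumes f: "f \<in> dual_space" and p: "p > 0"
    and A: "A \<subseteq> \<S>" and u0: "u0 \<in> weak_operator_topology closure_of A"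
    and C: "\<And>u. u \<in> A \<Longrightarrow> (\<lambda>v. \<bar>cmod (f (v (u \<xi>))) powr p - cmod (f (v (u0 \<xi>))) powr p\<bar>) \<in> C"
    and conv: "\<And>g h a. \<lbrakk>g \<in> C; h \<in> C; 0 \<le> a; a \<le> 1\<rbrakk> \<Longrightarrow> (\<lambda>v. a * g v + (1 - a) * h v) \<in> C"
    and e: "e > 0"
  obtains g where "g \<in> C" "\<And>s. g (\<pi> s) < e"
proof -
  let ?K = "subtopology weak_operator_topology \<S>"
  define \<Phi> where "\<Phi> v u = \<bar>cmod (f (v (u \<xi>))) powr p - cmod (f (v (u0 \<xi>))) powr p\<bar>" for v u
  have u0S: "u0 \<in> \<S>"
    using u0 closure_of_mono[OF A, of weak_operator_topology] by auto
  obtain b where b: "b \<ge> 0" "\<And>u. u \<in> \<S> \<Longrightarrow> cmod (f (u \<xi>)) \<le> b"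
    using coefficient_bounded[OF f] by blast
  have pw: "0 \<le> cmod (f (v (u \<xi>))) powr p \<and> cmod (f (v (u \<xi>))) powr p \<le> b powr p" if "v \<in> \<S>" "u \<in> \<S>" for u v
    using b(2)[OF closure_comp[OF that]] p by (auto intro!: powr_mono2)
  have "\<exists>g\<in>C. \<forall>v\<in>topspace ?K. g v < e"
  proof (rule uniformly_small_convex_combination[OF compact_space_closure compact_space_closure,
        where \<Phi> = \<Phi> and A = A and ?u0.0 = u0 and M = "b powr p"])
    show "continuous_map ?K euclideanreal (\<lambda>v. \<Phi> v u)" if "u \<in> topspace ?K" for u
    proof -
      have "continuous_map ?K euclideanreal (\<lambda>v. cmod (f (v x)) powr p)" for x
        using continuous_map_coefficient_powr[OF f p, of x 0] by simp
      then show ?thesis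
        unfolding \<Phi>_def by (intro continuous_map_real_abs continuous_map_diff)
    qed
    show "continuous_map ?K euclideanreal (\<Phi> v)" if "v \<in> topspace ?K" for v
      using continuous_map_coefficient_powr[OF dual_space_comp[OF f bounded_clinear_closure] p, of v \<xi>] that
      by (simp add: \<Phi>_def[abs_def] topspace_closure o_def)
    show "0 \<le> \<Phi> v u \<and> \<Phi> v u \<le> b powr p" if "v \<in> topspace ?K" "u \<in> topspace ?K" for v u
    proof -
      have "v \<in> \<S>" "u \<in> \<S>"
        using that by (simp_all only: topspace_closure)
      from pw[OF this] pw[OF this(1) u0S] show ?thesis
        unfolding \<Phi>_def by linarith
    qed
    show "u0 \<in> ?K closure_of A"
      using u0 u0S A by (simp add: closure_of_subtopology inf_absorb2)
    show "A \<subseteq> topspace ?K"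
      using A by (simp only: topspace_closure)
  qed (use C conv e in \<open>auto simp: \<Phi>_def\<close>)
  then show ?thesis
    using that rep_in_closure unfolding topspace_closure by blast
qed

text \<open>Convex combinations of the differences keep a \<psi>-value of at least e, yet some
  combination of their absolute values is uniformly small; boundedness of \<psi> excludes
  this.\<close>

lemma coefficient_power_not_separated:
  assumes \<psi>: "bounded_linear (\<psi> :: ('s \<Rightarrow>\<^sub>C complex) \<Rightarrow> real)"
    and f: "f \<in> dual_space" and p: "p > 0"
    and A: "A \<subseteq> \<S>" and u0: "u0 \<in> weak_operator_topology closure_of A" and e: "e > 0"
    and sep: "\<And>u. u \<in> A \<Longrightarrow> e \<le> \<psi> (coefficient_power \<pi> (u \<xi>) f p - coefficient_power \<pi> (u0 \<xi>) f p)"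
  shows False
proof -
  interpret \<psi>: bounded_linear \<psi> by fact
  obtain B where B: "B > 0" "\<And>g. norm (\<psi> g) \<le> norm g * B"
    using \<psi>.pos_bounded by blast
  \<comment> \<open>Members of C dominate on the range of \<open>\<pi>\<close> a bounded continuous
    function with \<psi>-value at least e; linearity of \<psi> and the triangle inequality make C
    convex. The threshold e / (2 * B) then forces a \<psi>-value of at most e / 2.\<close>
  define C where "C = {g. \<exists>v. e \<le> \<psi> v \<and> (\<forall>s. cmod (apply_bcontfun v s) \<le> g (\<pi> s))}"
  obtain g where g: "g \<in> C" "\<And>s. g (\<pi> s) < e / (2 * B)"
  proof (rule coefficient_powr_convex_combination[OF f p A u0, where C = C and e = "e / (2 * B)"])
    fix u assume "u \<in> A"
    then show "(\<lambda>v. \<bar>cmod (f (v (u \<xi>))) powr p - cmod (f (v (u0 \<xi>))) powr p\<bar>) \<in> C"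
      unfolding C_def
      by (auto intro!: exI[of _ "coefficient_power \<pi> (u \<xi>) f p - coefficient_power \<pi> (u0 \<xi>) f p"] sep
          simp: minus_bcontfun.rep_eq apply_coefficient_power[OF rep f p] simp flip: of_real_diff)
  next
    fix g h and a :: real assume gh: "g \<in> C" "h \<in> C" and a: "0 \<le> a" "a \<le> 1"
    then obtain v w where v: "e \<le> \<psi> v" "\<And>s. cmod (apply_bcontfun v s) \<le> g (\<pi> s)"
      and w: "e \<le> \<psi> w" "\<And>s. cmod (apply_bcontfun w s) \<le> h (\<pi> s)"
      by (auto simp: C_def)
    have "e \<le> \<psi> (a *\<^sub>R v + (1 - a) *\<^sub>R w)"
      using convex_bound_le[of "- \<psi> v" "- e" "- \<psi> w" a "1 - a"] v w a by (simp add: \<psi>.add \<psi>.scaleR)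
    moreover have "cmod (apply_bcontfun (a *\<^sub>R v + (1 - a) *\<^sub>R w) s) \<le> a * g (\<pi> s) + (1 - a) * h (\<pi> s)" for s
      using a v(2)[of s] w(2)[of s]
      by (auto simp: plus_bcontfun.rep_eq scaleR_bcontfun.rep_eq
          intro!: norm_triangle_le add_mono mult_left_mono)
    ultimately show "(\<lambda>v. a * g v + (1 - a) * h v) \<in> C"
      by (auto simp: C_def)
  qed (use e B in auto)
  then obtain v where v: "e \<le> \<psi> v" "\<And>s. cmod (apply_bcontfun v s) \<le> g (\<pi> s)"
    by (auto simp: C_def)
  have "norm v \<le> e / (2 * B)"
    using v(2) g(2) by (intro norm_bound) (meson less_imp_le order_trans)
  then have "norm v * B \<le> e / 2"
    using B(1) by (simp add: field_simps)
  then show False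
    using B(2)[of v] v(1) e by simp
qed

text \<open>If \<phi> deviates by e from its value at u0, then one of the real functionals Re
  \<phi>, -Re \<phi>, Im \<phi>, -Im \<phi> is at least e / 2 on the difference. As closure commutes
  with finite unions, one of these four would separate u0 from a set having u0 in its
  closure.\<close>

lemma continuous_map_coefficient_power:
  assumes f: "f \<in> dual_space" and p: "p > 0"
  shows "continuous_map (subtopology weak_operator_topology \<S>) weak_topology (\<lambda>u. coefficient_power \<pi> (u \<xi>) f p)"
  unfolding continuous_map_weak_topology_iff
proof
  fix \<phi> :: "('s \<Rightarrow>\<^sub>C complex) \<Rightarrow> complex" assume "\<phi> \<in> dual_space"
  then have bl: "bounded_linear \<phi>"
    by (simp add: dual_space_def bounded_clinear_def)
  then interpret \<phi>: bounded_linear \<phi> .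
  let ?K = "subtopology weak_operator_topology \<S>"
  let ?F = "\<lambda>u. coefficient_power \<pi> (u \<xi>) f p"
  have notin: "u0 \<notin> ?K closure_of {u \<in> \<S>. e \<le> cmod (\<phi> (?F u) - \<phi> (?F u0))}" if e: "e > 0" for u0 e
  proof
    define A where "A \<psi> = {u \<in> \<S>. e / 2 \<le> \<psi> (?F u - ?F u0)}" for \<psi> :: "('s \<Rightarrow>\<^sub>C complex) \<Rightarrow> real"
    assume "u0 \<in> ?K closure_of {u \<in> \<S>. e \<le> cmod (\<phi> (?F u) - \<phi> (?F u0))}"
    then have "u0 \<in> weak_operator_topology closure_of {u \<in> \<S>. e \<le> cmod (\<phi> (?F u) - \<phi> (?F u0))}"
      by (auto simp: closure_of_subtopology in_closure_of)
    also have "\<dots> \<subseteq> weak_operator_topology closure_of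
        (A (\<lambda>g. Re (\<phi> g)) \<union> A (\<lambda>g. - Re (\<phi> g)) \<union> A (\<lambda>g. Im (\<phi> g)) \<union> A (\<lambda>g. - Im (\<phi> g)))"
    proof (rule closure_of_mono, rule subsetI)
      fix u assume u: "u \<in> {u \<in> \<S>. e \<le> cmod (\<phi> (?F u) - \<phi> (?F u0))}"
      then have "e \<le> \<bar>Re (\<phi> (?F u - ?F u0))\<bar> + \<bar>Im (\<phi> (?F u - ?F u0))\<bar>"
        using cmod_le[of "\<phi> (?F u - ?F u0)"] by (simp add: \<phi>.diff)
      then have "e / 2 \<le> \<bar>Re (\<phi> (?F u - ?F u0))\<bar> \<or> e / 2 \<le> \<bar>Im (\<phi> (?F u - ?F u0))\<bar>"
        by linarith
      with u show "u \<in> A (\<lambda>g. Re (\<phi> g)) \<union> A (\<lambda>g. - Re (\<phi> g)) \<union> A (\<lambda>g. Im (\<phi> g)) \<union> A (\<lambda>g. - Im (\<phi> g))"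
        by (auto simp: A_def abs_if split: if_splits)
    qed
    finally obtain \<psi> where "bounded_linear \<psi>" "u0 \<in> weak_operator_topology closure_of (A \<psi>)"
      using bounded_linear_compose[OF bounded_linear_Re bl] bounded_linear_compose[OF bounded_linear_Im bl]
      by (auto intro: bounded_linear_minus)
    then show False
      using e by (elim coefficient_power_not_separated[OF _ f p, where e = "e / 2" and \<xi> = \<xi>]) (auto simp: A_def)
  qed
  show "continuous_map ?K euclidean (\<lambda>u. \<phi> (?F u))"
    unfolding continuous_map
  proof (intro conjI allI impI)
    fix U :: "complex set" assume "openin euclidean U"
    then have U: "open U" by simp
    show "openin ?K {u \<in> topspace ?K. \<phi> (?F u) \<in> U}"
    proof (subst openin_subopen, intro ballI)
      fix u0 assume u0: "u0 \<in> {u \<in> topspace ?K. \<phi> (?F u) \<in> U}"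
      then obtain e where e: "e > 0" "\<And>z. cmod (z - \<phi> (?F u0)) < e \<Longrightarrow> z \<in> U"
        using U by (auto simp: open_contains_ball dist_norm norm_minus_commute subset_iff)
      define T where "T = topspace ?K - ?K closure_of {u \<in> \<S>. e \<le> cmod (\<phi> (?F u) - \<phi> (?F u0))}"
      have "openin ?K T"
        unfolding T_def by (intro openin_diff openin_topspace closedin_closure_of)
      moreover have "u0 \<in> T"
        using u0 notin[OF e(1)] by (simp add: T_def)
      moreover have "T \<subseteq> {u \<in> topspace ?K. \<phi> (?F u) \<in> U}"
      proof
        fix u assume u: "u \<in> T"
        have "{u \<in> \<S>. e \<le> cmod (\<phi> (?F u) - \<phi> (?F u0))} \<subseteq> topspace ?K"
          unfolding topspace_closure by blast
        from closure_of_subset[OF this] u have "u \<notin> {u \<in> \<S>. e \<le> cmod (\<phi> (?F u) - \<phi> (?F u0))}"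
          unfolding T_def by blast
        with u e(2) show "u \<in> {u \<in> topspace ?K. \<phi> (?F u) \<in> U}"
          by (auto simp: T_def topspace_closure not_le)
      qed
      ultimately show "\<exists>T. openin ?K T \<and> u0 \<in> T \<and> T \<subseteq> {u \<in> topspace ?K. \<phi> (?F u) \<in> U}"
        by blast
    qed
  qed simp
qed

lemma right_translate_coefficient_power:
  assumes "f \<in> dual_space" "p > 0"
  shows "right_translate s (coefficient_power \<pi> \<xi> f p) = coefficient_power \<pi> (\<pi> s \<xi>) f p"
  by (rule bcontfun_eqI) (simp add: right_translate.rep_eq apply_coefficient_power[OF rep assms] rep_mult)

text \<open>The right translate by s is the value at \<open>\<pi> s\<close> of a map that is
  continuous from \<open>\<S>\<close> to the weak topology, so the orbit lies in a compact
  image.\<close>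

theorem coefficient_power_in_wap:
  assumes "f \<in> dual_space" "p > 0"
  shows "coefficient_power \<pi> \<xi> f p \<in> wap"
proof -
  let ?F = "\<lambda>u. coefficient_power \<pi> (u \<xi>) f p"
  have "compactin weak_topology (?F ` \<S>)"
    by (intro image_compactin[OF _ continuous_map_coefficient_power[OF assms]])
      (simp add: compactin_subtopology compact_closure)
  then show ?thesis
    unfolding wap_iff using rep_in_closure
    by (intro exI[of _ "?F ` \<S>"]) (auto simp: right_translate_coefficient_power[OF assms])
qed

section \<open>Vanishing means and almost weak stability\<close>

context
  fixes m :: "('s \<Rightarrow>\<^sub>C complex) \<Rightarrow> complex"
  assumes m: "bi_invariant_mean m"
begin

lemma mean_add: "f \<in> wap \<Longrightarrow> g \<in> wap \<Longrightarrow> m (f + g) = m f + m g"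
  using m by (simp add: bi_invariant_mean_def)

lemma mean_scaleR: "f \<in> wap \<Longrightarrow> m (r *\<^sub>R f) = r *\<^sub>R m f"
  using m by (simp add: bi_invariant_mean_def scaleR_conv_of_real flip: scaleC_of_real)

lemma mean_nonneg: "f \<in> wap \<Longrightarrow> (\<And>t. apply_bcontfun f t \<in> \<real>\<^sub>\<ge>\<^sub>0) \<Longrightarrow> m f \<in> \<real>\<^sub>\<ge>\<^sub>0"
  using m by (simp add: bi_invariant_mean_def)

lemma mean_mono:
  assumes "f \<in> wap" "g \<in> wap" "\<And>t. apply_bcontfun g t - apply_bcontfun f t \<in> \<real>\<^sub>\<ge>\<^sub>0"
  shows "m g - m f \<in> \<real>\<^sub>\<ge>\<^sub>0"
proof -
  have "m (g + (-1) *\<^sub>R f) \<in> \<real>\<^sub>\<ge>\<^sub>0"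
    using assms by (intro mean_nonneg wap_add wap_scaleR) (simp_all add: plus_bcontfun.rep_eq)
  moreover have "m (g + (-1) *\<^sub>R f) = m g - m f"
    using mean_add[OF assms(2) wap_scaleR[OF assms(1)], of "-1"] mean_scaleR[OF assms(1), of "-1"]
    by simp
  ultimately show ?thesis
    by simp
qed

lemma aws_imp_mean_zero:
  assumes \<xi>: "\<xi> \<in> E_aws \<pi>" and f: "f \<in> dual_space" and p: "p > 0"
  shows "m (coefficient_power \<pi> \<xi> f p) = 0"
proof -
  let ?F = "\<lambda>u. coefficient_power \<pi> (u \<xi>) f p"
  let ?c = "coefficient_power \<pi> \<xi> f p"
  obtain u0 where u0: "u0 \<in> \<S>" "u0 \<xi> = 0"
    using \<xi> by (auto simp: E_aws_def)
  have cw: "?c \<in> wap"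
    by (rule coefficient_power_in_wap[OF f p])
  have f0: "f (v 0) = 0" if "v \<in> \<S>" for v
    using bounded_clinear_zero[OF bounded_clinear_closure[OF that]] f
    by (simp add: dual_space_def bounded_clinear_zero)
  \<comment> \<open>Members of C dominate on the range of \<open>\<pi>\<close> a real-valued element
    of \<open>wap\<close> with the same mean as \<open>?c\<close>. The functions for u =
    \<open>\<pi> t\<close> qualify by right invariance: as \<open>u0 \<xi>\<close> = 0, they
    coincide there with right translates of \<open>?c\<close>.\<close>
  define C where "C = {g. \<exists>v\<in>wap. m v = m ?c \<and> (\<forall>s. \<exists>r. apply_bcontfun v s = complex_of_real r \<and> r \<le> g (\<pi> s))}"
  have small: "complex_of_real e * m (const_bcontfun 1) - m ?c \<in> \<real>\<^sub>\<ge>\<^sub>0" if e: "e > 0" for e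
  proof -
    obtain g where g: "g \<in> C" "\<And>s. g (\<pi> s) < e"
    proof (rule coefficient_powr_convex_combination[OF f p range_subset_closure u0(1), where C = C])
      fix u assume "u \<in> range \<pi>"
      then obtain t where u: "u = \<pi> t" by auto
      have "right_translate t ?c \<in> wap"
        unfolding right_translate_coefficient_power[OF f p] by (rule coefficient_power_in_wap[OF f p])
      moreover have "m (right_translate t ?c) = m ?c"
        using m cw by (simp add: bi_invariant_mean_def)
      ultimately show "(\<lambda>v. \<bar>cmod (f (v (u \<xi>))) powr p - cmod (f (v (u0 \<xi>))) powr p\<bar>) \<in> C"
        unfolding C_def mem_Collect_eq
        by (intro bexI[of _ "right_translate t ?c"])
          (auto simp: u u0(2) f0[OF rep_in_closure] right_translate.rep_eq
            apply_coefficient_power[OF rep f p] rep_mult)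
    next
      fix g h and a :: real assume gh: "g \<in> C" "h \<in> C" and a: "0 \<le> a" "a \<le> 1"
      then obtain v w where v: "v \<in> wap" "m v = m ?c" "\<And>s. \<exists>r. apply_bcontfun v s = complex_of_real r \<and> r \<le> g (\<pi> s)"
        and w: "w \<in> wap" "m w = m ?c" "\<And>s. \<exists>r. apply_bcontfun w s = complex_of_real r \<and> r \<le> h (\<pi> s)"
        by (auto simp: C_def)
      have "m (a *\<^sub>R v + (1 - a) *\<^sub>R w) = m ?c"
        by (simp only: mean_add mean_scaleR wap_scaleR v w flip: scaleR_add_left) simp
      moreover have "\<exists>r. apply_bcontfun (a *\<^sub>R v + (1 - a) *\<^sub>R w) s = complex_of_real r \<and>
          r \<le> a * g (\<pi> s) + (1 - a) * h (\<pi> s)" for s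
      proof -
        obtain r r' where r: "apply_bcontfun v s = complex_of_real r" "r \<le> g (\<pi> s)"
          "apply_bcontfun w s = complex_of_real r'" "r' \<le> h (\<pi> s)"
          using v(3) w(3) by metis
        then show ?thesis
          using a by (intro exI[of _ "a * r + (1 - a) * r'"])
            (auto simp: plus_bcontfun.rep_eq scaleR_bcontfun.rep_eq scaleR_conv_of_real
              intro!: add_mono mult_left_mono)
      qed
      ultimately show "(\<lambda>v. a * g v + (1 - a) * h v) \<in> C"
        using v(1) w(1) by (auto simp: C_def intro!: bexI[of _ "a *\<^sub>R v + (1 - a) *\<^sub>R w"] wap_add wap_scaleR)
    qed (use e in auto)
    then obtain v where v: "v \<in> wap" "m v = m ?c" "\<And>s. \<exists>r. apply_bcontfun v s = complex_of_real r \<and> r \<le> g (\<pi> s)"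
      by (auto simp: C_def)
    have "m (e *\<^sub>R const_bcontfun 1) - m v \<in> \<real>\<^sub>\<ge>\<^sub>0"
    proof (intro mean_mono v wap_scaleR wap_const)
      fix s
      obtain r where "apply_bcontfun v s = complex_of_real r" "r < e"
        using v(3)[of s] g(2)[of s] by auto
      then show "apply_bcontfun (e *\<^sub>R const_bcontfun 1) s - apply_bcontfun v s \<in> \<real>\<^sub>\<ge>\<^sub>0"
        by (simp add: scaleR_bcontfun.rep_eq const_bcontfun.rep_eq complex_nonneg_Reals_iff)
    qed
    then show ?thesis
      by (simp add: v(2) mean_scaleR wap_const scaleR_conv_of_real)
  qed
  have "m ?c \<in> \<real>\<^sub>\<ge>\<^sub>0" 
    using cw by (intro mean_nonneg) (auto simp: apply_coefficient_power[OF rep f p])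
  moreover have "m (const_bcontfun 1) \<in> \<real>\<^sub>\<ge>\<^sub>0"
    by (intro mean_nonneg wap_const) (simp add: const_bcontfun.rep_eq)
  ultimately obtain r k where r: "m ?c = complex_of_real r" "r \<ge> 0"
    and k: "m (const_bcontfun 1) = complex_of_real k" "k \<ge> 0"
    by (auto elim!: nonneg_Reals_cases)
  have "r \<le> e * k" if "e > 0" for e
    using small[OF that] by (simp add: r k complex_nonneg_Reals_iff)
  then have "r \<le> 0 + e" if "e > 0" for e
  proof -
    \<comment> \<open>The mean k of the constant 1 is known here only to be nonnegative; k + 1
      avoids a division by zero.\<close>
    have "e / (k + 1) > 0" using k(2) that by simp
    then have "r \<le> e / (k + 1) * k" using \<open>\<And>e. e > 0 \<Longrightarrow> r \<le> e * k\<close> by blast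
    also have "\<dots> \<le> e" using k(2) that by (simp add: field_simps)
    finally show ?thesis by simp
  qed
  then have "r \<le> 0"
    by (rule field_le_epsilon)
  then show ?thesis
    using r by simp
qed

lemma mean_zero_imp_aws:
  assumes p: "p > 0" and zero: "\<And>f. f \<in> dual_space \<Longrightarrow> m (coefficient_power \<pi> \<xi> f p) = 0"
  shows "\<xi> \<in> E_aws \<pi>"
proof -
  \<comment> \<open>The operator sought lies in \<open>\<S>\<close> and in all these closed sets. By
    compactness it suffices to meet finitely many of them, which \<open>approx\<close> achieves
    within the range of \<open>\<pi>\<close>.\<close>
  define Z where "Z = (\<lambda>(f, e). {u \<in> topspace weak_operator_topology. f (u \<xi>) \<in> cball (0::complex) e})"
  have approx: "\<exists>s. \<forall>(f, e)\<in>I. cmod (f (\<pi> s \<xi>)) \<le> e"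
    if I: "finite I" "I \<subseteq> dual_space \<times> {0<..}" for I
  proof (rule ccontr)
    assume "\<not> ?thesis"
    then have ex: "\<exists>(f, e)\<in>I. e < cmod (f (\<pi> s \<xi>))" for s
      by (force simp: not_le)
    \<comment> \<open>Dividing by the p-th power of the bound makes the term of a violated condition
      at least 1. By \<open>ex\<close> some condition is violated at every s, so the sum of these
      nonnegative functions is at least 1 everywhere.\<close>
    define h where "h i = inverse (snd i powr p) *\<^sub>R coefficient_power \<pi> \<xi> (fst i) p" for i
    have "(\<Sum>i\<in>J. h i) \<in> wap \<and> m (\<Sum>i\<in>J. h i) = 0" if "J \<subseteq> I" for J
      using finite_subset[OF that I(1)] that
    proof (induction J rule: finite_induct)
      case empty
      show ?case
        using wap_scaleR[OF wap_const, of 0 0] mean_scaleR[OF wap_const, of 0 0] by simp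
    next
      case (insert i J)
      then have "fst i \<in> dual_space" using I by auto
      then have "h i \<in> wap" "m (h i) = 0"
        using p by (auto simp: h_def coefficient_power_in_wap mean_scaleR zero intro: wap_scaleR)
      with insert show ?case by (simp add: wap_add mean_add)
    qed
    then have sw: "(\<Sum>i\<in>I. h i) \<in> wap" and s0: "m (\<Sum>i\<in>I. h i) = 0"
      by auto
    have "m (\<Sum>i\<in>I. h i) - m (const_bcontfun 1) \<in> \<real>\<^sub>\<ge>\<^sub>0"
    proof (intro mean_mono sw wap_const)
      fix t
      define x where "x i = (cmod (fst i (\<pi> t \<xi>)) powr p) / (snd i powr p)" for i
      obtain f e where fe: "(f, e) \<in> I" "e < cmod (f (\<pi> t \<xi>))"
        using ex[of t] by auto
      have "e > 0" using fe I by auto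
      then have "1 \<le> x (f, e)"
        using fe p by (simp add: x_def divide_simps powr_mono2)
      also have "\<dots> \<le> (\<Sum>i\<in>I. x i)"
        using fe I by (intro member_le_sum) (auto simp: x_def)
      finally have "1 \<le> (\<Sum>i\<in>I. x i)" .
      moreover have "apply_bcontfun (\<Sum>i\<in>J. h i) t = complex_of_real (\<Sum>i\<in>J. x i)" if "J \<subseteq> I" for J
        using finite_subset[OF that I(1)] that
      proof (induction J rule: finite_induct)
        case (insert i J)
        then have "fst i \<in> dual_space" using I by auto
        with insert show ?case
          by (simp add: plus_bcontfun.rep_eq h_def x_def scaleR_bcontfun.rep_eq
              apply_coefficient_power[OF rep _ p] scaleR_conv_of_real divide_inverse mult.commute)
      qed (simp add: zero_bcontfun.rep_eq)
      ultimately show "apply_bcontfun (\<Sum>i\<in>I. h i) t - apply_bcontfun (const_bcontfun 1) t \<in> \<real>\<^sub>\<ge>\<^sub>0"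
        by (simp add: const_bcontfun.rep_eq complex_nonneg_Reals_iff)
    qed
    moreover have "m (const_bcontfun 1) \<in> \<real>\<^sub>\<ge>\<^sub>0"
      by (intro mean_nonneg wap_const) (simp add: const_bcontfun.rep_eq)
    \<comment> \<open>The sum has mean 0 and dominates 1, so the mean of 1 is squeezed to 0.\<close>
    ultimately have "m (const_bcontfun 1) = 0"
      by (simp add: s0 complex_nonneg_Reals_iff complex_eq_iff)
    then show False
      using bi_invariant_mean_one_nonzero[OF m] by simp
  qed
  have "\<S> \<inter> \<Inter> (Z ` (dual_space \<times> {0<..})) \<noteq> {}"
  proof (rule compactin_fip[THEN iffD1, OF compact_closure, THEN conjunct2, rule_format], intro conjI ballI allI impI)
    fix V assume "V \<in> Z ` (dual_space \<times> {0<..})"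
    then obtain f e where V: "V = Z (f, e)" and f: "f \<in> dual_space"
      by auto
    show "closedin weak_operator_topology V"
      unfolding V Z_def prod.case
      by (intro closedin_continuous_map_preimage[OF continuous_map_coefficient[OF f]]) simp
  next
    fix \<F> assume "finite \<F> \<and> \<F> \<subseteq> Z ` (dual_space \<times> {0<..})"
    then obtain I where I: "finite I" "I \<subseteq> dual_space \<times> {0<..}" "\<F> = Z ` I"
      by (metis finite_subset_image)
    obtain s where "\<forall>(f, e)\<in>I. cmod (f (\<pi> s \<xi>)) \<le> e"
      using approx[OF I(1,2)] by blast
    then have "\<pi> s \<in> \<S> \<inter> \<Inter> \<F>"
      using rep_in_closure bounded_clinear_closure[OF rep_in_closure] by (fastforce simp: I(3) Z_def)
    then show "\<S> \<inter> \<Inter> \<F> \<noteq> {}" by blast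
  qed
  then obtain u where u: "u \<in> \<S>" and uz: "\<And>f e. f \<in> dual_space \<Longrightarrow> e > 0 \<Longrightarrow> u \<in> Z (f, e)"
    by auto
  have "f (u \<xi>) = 0" if "f \<in> dual_space" for f
  proof -
    have "cmod (f (u \<xi>)) \<le> 0 + e" if "e > 0" for e
      using uz[OF \<open>f \<in> dual_space\<close> that] by (simp add: Z_def)
    then have "cmod (f (u \<xi>)) \<le> 0"
      by (rule field_le_epsilon)
    then show ?thesis by simp
  qed
  then have "u \<xi> = 0"
    using dual_space_separates_zero by blast
  with u show ?thesis
    by (auto simp: E_aws_def)
qed

end

end

theorem lemma4p1:
  fixes m :: "('s::semitopological_semigroup \<Rightarrow>\<^sub>C complex) \<Rightarrow> complex"
    and \<pi> :: "'s \<Rightarrow> 'e::complex_banach \<Rightarrow> 'e"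
    and \<xi> :: 'e
  assumes "bi_invariant_mean m"
    and "relatively_weakly_compact_rep \<pi>"
  shows "(\<xi> \<in> E_aws \<pi> \<longleftrightarrow>
           (\<forall>p>0. \<forall>f'\<in>dual_space. m (coefficient_power \<pi> \<xi> f' p) = 0)) \<and>
         ((\<forall>p>0. \<forall>f'\<in>dual_space. m (coefficient_power \<pi> \<xi> f' p) = 0) \<longleftrightarrow>
           (\<exists>p>0. \<forall>f'\<in>dual_space. m (coefficient_power \<pi> \<xi> f' p) = 0))"
  \<comment> \<open>The three conditions imply each other in a circle; p = 1 witnesses the step from
    all p to some p.\<close>
  using aws_imp_mean_zero[OF assms(2,1)] mean_zero_imp_aws[OF assms(2,1)]
  by (meson zero_less_one)

end
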